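(* Let $\mathfrak{A}$ be a $C^*$-algebra and $\mathfrak{B}$ be a von Neumann algebra that both act on a Hilbert space $\mathcal{H}$. Let $\mathcal{M}$ be an inner product $\mathfrak{A}$-module and let $\mathcal{N}$ be an inner product $\mathfrak{B}$-module with the following property: for each norm-bounded sequence $(v_n)$ in $\mathcal{N}$ there exist a subsequence $(v_{l_n})$ of $(v_n)$ and $v_0\in\mathcal{N}$ such that $\|\langle v_{l_n},w\rangle-\langle v_0,w\rangle\|\to 0$ as $n\to\infty$ for all $w\in\mathcal{N}$. Let $\varphi\colon\mathcal{M}\times\mathcal{M}\to[0,\infty)$ be a mapping for which there is a constant $c>0$, $c\neq 1$, such that (a) $\lim_{n\to\infty}c^{n}\varphi(c^{-n}x,y)=0$ and $\lim_{n\to\infty}c^{n}\varphi(x,c^{-n}y)=0$ for any fixed $x,y\in\mathcal{M}$; (b) the sequence $\big(c^{2n}\varphi(c^{-n}x,c^{-n}x)\big)_n$ is bounded for any fixed $x\in\mathcal{M}$. Then for each mapping $f\colon\mathcal{M}\to\mathcal{N}$ satisfying $$\big\|\,|\langle f(x),f(y)\rangle|-|\langle x,y\rangle|\,\big\|\leq\varphi(x,y)\qquad(x,y\in\mathcal{M}),$$ there exists $I\colon\mathcal{M}\to\mathcal{N}$ with the following properties: (i) $\langle I(x),I(x)\rangle=\langle x,x\rangle$ for all $x\in\mathcal{M}$; (ii) $I$ preserves orthogonality in both directions, that is, for $x,y\in\mathcal{M}$, $\langle x,y\rangle=0$ if and only if $\langle I(x),I(y)\rangle=0$; (iii) $\|f(x)-I(x)\|\leq\sqrt{\varphi(x,x)}$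 for all $x\in\mathcal{M}$. Furthermore, there exists $h\colon\mathcal{M}\to\mathcal{N}$ such that the following decomposition holds for all $x\in\mathcal{M}$: $$f(x)=h(x)+I(x),\qquad\langle h(x),I(x)\rangle=0\qquad\text{and}\qquad\|h(x)\|\leq\sqrt{\varphi(x,x)}.$$ If $\mathfrak{B}$ is abelian, then $I$ can be chosen so that it is also a solution of the Wigner equation $$|\langle I(x),I(y)\rangle|=|\langle x,y\rangle|\qquad(x,y\in\mathcal{M}).$$
   Context: A $C^*$-algebra acting on a Hilbert space $\mathcal{H}$ means a $C^*$-subalgebra of $\mathbb{B}(\mathcal{H})$, the algebra of bounded linear operators on the complex Hilbert space $\mathcal{H}$. A von Neumann algebra acting on $\mathcal{H}$ is a $C^*$-subalgebra of $\mathbb{B}(\mathcal{H})$ which contains the identity operator $id_{\mathcal{H}}$ and is closed in the weak operator topology. For an element $a$ of a $C^*$-algebra, $|a|$ denotes the unique positive square root of $a^*a$. Elements of $\mathfrak{A}$ and $\mathfrak{B}$ are both regarded as operators in $\mathbb{B}(\mathcal{H})$, so they can be compared and subtracted there, with the operator norm. A (right) inner product $\mathfrak{A}$-module $\mathcal{X}$ over a $C^*$-algebra $\mathfrak{A}$ is an algebraic right $\mathfrak{A}$-module which is a complex linear space with $(\lambda x)a=x(\lambda a)=\lambda(xa)$ for all $x\in\mathcal{X}$, $a\in\mathfrak{A}$, $\lambda\in\mathbb{C}$, together with a mapping $\langle\cdot,\cdot\rangle\colon\mathcal{X}\times\mathcal{X}\to\mathfrak{A}$ satisfying, for all $x,y,z\in\mathcal{X}$,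 $a\in\mathfrak{A}$, $\lambda\in\mathbb{C}$: $\langle x,x\rangle\geq0$, and $\langle x,x\rangle=0$ iff $x=0$; $\langle x,\lambda y+z\rangle=\lambda\langle x,y\rangle+\langle x,z\rangle$; $\langle x,ya\rangle=\langle x,y\rangle a$; $\langle y,x\rangle=\langle x,y\rangle^*$. It is normed by $\|x\|=\sqrt{\|\langle x,x\rangle\|}$ (completeness is not assumed). *)

theory Defs
  imports "HOL-Analysis.Analysis"
begin

class complex_vector = ab_group_add +
  fixes scaleC :: "complex \<Rightarrow> 'a \<Rightarrow> 'a"  (infixr "*\<^sub>C" 75)
  assumes scaleC_add_right: "c *\<^sub>C (x + y) = c *\<^sub>C x + c *\<^sub>C y"
    and scaleC_add_left: "(c + d) *\<^sub>C x = c *\<^sub>C x + d *\<^sub>C x"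
    and scaleC_scaleC: "c *\<^sub>C (d *\<^sub>C x) = (c * d) *\<^sub>C x"
    and scaleC_one: "1 *\<^sub>C x = x"

text \<open>Complex Hilbert spaces. The inner product is linear in the second argument; completeness
  is part of \<^class>\<open>banach\<close>.\<close>

class complex_hilbert_space = complex_vector + banach +
  fixes cinner :: "'a \<Rightarrow> 'a \<Rightarrow> complex"
  assumes scaleR_scaleC: "r *\<^sub>R x = complex_of_real r *\<^sub>C x"
    and cinner_add_right: "cinner x (y + z) = cinner x y + cinner x z"
    and cinner_scaleC_right: "cinner x (c *\<^sub>C y) = c * cinner x y"
    and cinner_commute: "cinner y x = cnj (cinner x y)"
    and cinner_ge_zero: "0 \<le> Re (cinner x x)"
    and cinner_eq_zero_iff: "cinner x x = 0 \<longleftrightarrow> x = 0"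
    and norm_eq_sqrt_cinner: "norm x = sqrt (Re (cinner x x))"

text \<open>The type \<open>'h \<Rightarrow>\<^sub>L 'h\<close> consists of the bounded \<^emph>\<open>real\<close>-linear maps, with the operator norm;
  the bounded complex-linear operators form the following subset of it.\<close>

definition bounded_ops :: "('h::complex_hilbert_space \<Rightarrow>\<^sub>L 'h) set" where
  "bounded_ops = {T. \<forall>c x. blinfun_apply T (c *\<^sub>C x) = c *\<^sub>C blinfun_apply T x}"

lemma norm_scaleC: "norm (c *\<^sub>C x) = cmod c * norm (x::'h::complex_hilbert_space)"
proof -
  have "cinner (c *\<^sub>C x) (c *\<^sub>C x) = c * cnj c * cinner x x"
    by (metis cinner_commute cinner_scaleC_right complex_cnj_mult mult.assoc)
  also have "\<dots> = complex_of_real ((cmod c)\<^sup>2) * cinner x x"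
    by (simp only: complex_norm_square)
  finally have "Re (cinner (c *\<^sub>C x) (c *\<^sub>C x)) = (cmod c)\<^sup>2 * Re (cinner x x)"
    by simp
  then show ?thesis
    by (simp add: norm_eq_sqrt_cinner real_sqrt_mult)
qed

lemma bounded_linear_scaleC: "bounded_linear (\<lambda>x::'h::complex_hilbert_space. c *\<^sub>C x)"
proof (rule bounded_linear_intro[where K = "cmod c"])
  fix r :: real and x :: 'h
  show "c *\<^sub>C (r *\<^sub>R x) = r *\<^sub>R (c *\<^sub>C x)"
    by (simp add: scaleR_scaleC scaleC_scaleC mult.commute)
qed (simp_all add: scaleC_add_right norm_scaleC mult.commute)

lift_definition scaleC_op ::
    "complex \<Rightarrow> ('h::complex_hilbert_space \<Rightarrow>\<^sub>L 'h) \<Rightarrow> ('h \<Rightarrow>\<^sub>L 'h)" is "\<lambda>c T x. c *\<^sub>C T x"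
  by (rule bounded_linear_compose[OF bounded_linear_scaleC])

definition adj :: "('h::complex_hilbert_space \<Rightarrow>\<^sub>L 'h) \<Rightarrow> ('h \<Rightarrow>\<^sub>L 'h)" where
  "adj T = (THE S. \<forall>x y. cinner (blinfun_apply S x) y = cinner x (blinfun_apply T y))"

definition positive_op :: "('h::complex_hilbert_space \<Rightarrow>\<^sub>L 'h) \<Rightarrow> bool" where
  "positive_op T \<longleftrightarrow> T \<in> bounded_ops \<and>
     (\<forall>x. cinner x (blinfun_apply T x) \<in> \<real> \<and> 0 \<le> Re (cinner x (blinfun_apply T x)))"

definition abs_op :: "('h::complex_hilbert_space \<Rightarrow>\<^sub>L 'h) \<Rightarrow> ('h \<Rightarrow>\<^sub>L 'h)" where
  "abs_op T = (THE P. positive_op P \<and> P o\<^sub>L P = adj T o\<^sub>L T)"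

definition cstar_subalgebra :: "('h::complex_hilbert_space \<Rightarrow>\<^sub>L 'h) set \<Rightarrow> bool" where
  "cstar_subalgebra A \<longleftrightarrow>
     A \<subseteq> bounded_ops \<and> 0 \<in> A \<and>
     (\<forall>a\<in>A. \<forall>b\<in>A. a + b \<in> A) \<and>
     (\<forall>c. \<forall>a\<in>A. scaleC_op c a \<in> A) \<and>
     (\<forall>a\<in>A. \<forall>b\<in>A. a o\<^sub>L b \<in> A) \<and>
     (\<forall>a\<in>A. adj a \<in> A) \<and>
     closed A"

text \<open>The coarsest topology on \<^const>\<open>bounded_ops\<close> making all matrix coefficients continuous.\<close>

definition weak_operator_topology :: "('h::complex_hilbert_space \<Rightarrow>\<^sub>L 'h) topology" where
  "weak_operator_topology = topology_generated_by
     {{T \<in> bounded_ops. cinner x (blinfun_apply T y) \<in> U} | x y U. open U}"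

definition von_neumann_algebra :: "('h::complex_hilbert_space \<Rightarrow>\<^sub>L 'h) set \<Rightarrow> bool" where
  "von_neumann_algebra B \<longleftrightarrow>
     cstar_subalgebra B \<and> id_blinfun \<in> B \<and> closedin weak_operator_topology B"

definition abelian :: "('h::complex_hilbert_space \<Rightarrow>\<^sub>L 'h) set \<Rightarrow> bool" where
  "abelian B \<longleftrightarrow> (\<forall>a\<in>B. \<forall>b\<in>B. a o\<^sub>L b = b o\<^sub>L a)"

text \<open>Inner product modules over a C*-algebra \<open>A\<close> of operators. The right action \<open>act x a\<close> is only
  constrained for \<open>a \<in> A\<close>.\<close>

locale inner_product_module =
  fixes A :: "('h::complex_hilbert_space \<Rightarrow>\<^sub>L 'h) set"
    and act :: "'m::complex_vector \<Rightarrow> ('h \<Rightarrow>\<^sub>L 'h) \<Rightarrow> 'm"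
    and ip :: "'m \<Rightarrow> 'm \<Rightarrow> ('h \<Rightarrow>\<^sub>L 'h)"
  assumes cstar: "cstar_subalgebra A"
    and act_add_left: "a \<in> A \<Longrightarrow> act (x + y) a = act x a + act y a"
    and act_add_right: "a \<in> A \<Longrightarrow> b \<in> A \<Longrightarrow> act x (a + b) = act x a + act x b"
    and act_mult: "a \<in> A \<Longrightarrow> b \<in> A \<Longrightarrow> act x (a o\<^sub>L b) = act (act x a) b"
    and act_scaleC_left: "a \<in> A \<Longrightarrow> act (c *\<^sub>C x) a = c *\<^sub>C act x a"
    and act_scaleC_right: "a \<in> A \<Longrightarrow> act x (scaleC_op c a) = c *\<^sub>C act x a"
    and ip_in: "ip x y \<in> A"
    and ip_positive: "positive_op (ip x x)"
    and ip_eq_zero_iff: "ip x x = 0 \<longleftrightarrow> x = 0"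
    and ip_add_right: "ip x (y + z) = ip x y + ip x z"
    and ip_scaleC_right: "ip x (c *\<^sub>C y) = scaleC_op c (ip x y)"
    and ip_act_right: "a \<in> A \<Longrightarrow> ip x (act y a) = ip x y o\<^sub>L a"
    and ip_commute: "ip y x = adj (ip x y)"

definition module_norm ::
    "('m \<Rightarrow> 'm \<Rightarrow> ('h::complex_hilbert_space \<Rightarrow>\<^sub>L 'h)) \<Rightarrow> 'm \<Rightarrow> real" where
  "module_norm ip x = sqrt (norm (ip x x))"

end

theory Submission
  imports Defs
begin

text \<open>Put \<open>f\<^sub>n x = c\<^sup>n f (c\<^sup>-\<^sup>n x)\<close>. By (b) this sequence is bounded, so it has a weak cluster
  point \<open>J x\<close>, and (a) gives \<open>|\<langle>J x, f y\<rangle>| = |\<langle>f x, J y\<rangle>| = |\<langle>J x, J y\<rangle>| = |\<langle>x, y\<rangle>|\<close>. It remains to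
  correct the phase of \<open>J x\<close>. With \<open>D = \<langle>x, x\<rangle>\<close> and \<open>T = \<langle>J x, f x\<rangle>\<close> one has \<open>T\<^sup>* T = T T\<^sup>* = D\<^sup>2\<close>, and
  \<open>I x\<close> should be \<open>J x \<cdot> u\<close> for the polar part \<open>u\<close> of \<open>T\<close>. Instead of constructing \<open>u\<close> in the von
  Neumann algebra, \<open>I x\<close> is obtained as a weak cluster point of \<open>J x \<cdot> T q\<^sub>n\<close>, where
  \<open>q\<^sub>n = s\<^sup>-\<^sup>1 (1 + E + \<dots> + E\<^bsup>n-1\<^esup>)\<close> with \<open>E = 1 - D/s\<close> are approximate inverses of \<open>D\<close>. Then
  \<open>\<langle>I x, f x\<rangle> = D = \<langle>I x, I x\<rangle>\<close>, which makes \<open>f x - I x\<close> orthogonal to \<open>I x\<close>, and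
  \<open>I x \<cdot> D = J x \<cdot> T\<close>, from which the relations between \<open>\<langle>I x, I y\<rangle>\<close> and \<open>\<langle>J x, J y\<rangle>\<close> follow.\<close>

section \<open>Complex Hilbert spaces\<close>

lemma cinner_add_left: "cinner (x + y) (z::'h::complex_hilbert_space) = cinner x z + cinner y z"
  by (metis cinner_add_right cinner_commute complex_cnj_add)

lemma cinner_scaleC_left: "cinner (c *\<^sub>C x) (y::'h::complex_hilbert_space) = cnj c * cinner x y"
  by (metis cinner_commute cinner_scaleC_right complex_cnj_mult)

lemma cinner_scaleR_right: "cinner x (r *\<^sub>R (y::'h::complex_hilbert_space)) = of_real r * cinner x y"
  by (simp add: scaleR_scaleC cinner_scaleC_right)

lemma cinner_scaleR_left: "cinner (r *\<^sub>R x) (y::'h::complex_hilbert_space) = of_real r * cinner x y"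
  by (simp add: scaleR_scaleC cinner_scaleC_left)

lemma cinner_minus_right: "cinner x (- (y::'h::complex_hilbert_space)) = - cinner x y"
  using cinner_scaleR_right[of x "-1" y] by simp

lemma cinner_minus_left: "cinner (- x) (y::'h::complex_hilbert_space) = - cinner x y"
  using cinner_scaleR_left[of "-1" x y] by simp

lemma cinner_diff_right: "cinner x (y - (z::'h::complex_hilbert_space)) = cinner x y - cinner x z"
  using cinner_add_right[of x y "- z"] by (simp add: cinner_minus_right)

lemma cinner_diff_left: "cinner (x - y) (z::'h::complex_hilbert_space) = cinner x z - cinner y z"
  using cinner_add_left[of x "- y" z] by (simp add: cinner_minus_left)

lemma cinner_zero_right [simp]: "cinner x (0::'h::complex_hilbert_space) = 0"
  using cinner_diff_right[of x 0 0] by simp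

lemma cinner_zero_left [simp]: "cinner (0::'h::complex_hilbert_space) x = 0"
  using cinner_diff_left[of 0 0 x] by simp

lemmas cinner_simps = cinner_add_left cinner_add_right cinner_diff_left cinner_diff_right
  cinner_scaleR_left cinner_scaleR_right

lemma Re_cinner_commute: "Re (cinner x y) = Re (cinner y (x::'h::complex_hilbert_space))"
  by (subst cinner_commute) simp

lemma Re_cinner_self: "Re (cinner x (x::'h::complex_hilbert_space)) = (norm x)\<^sup>2"
  by (simp add: norm_eq_sqrt_cinner cinner_ge_zero)

text \<open>Rotating the second argument by \<open>\<i>\<close> exchanges real and imaginary parts,
  so most arguments can be run with the real form \<open>Re (cinner x y)\<close>.\<close>

lemma Im_cinner: "Im (cinner x y) = - Re (cinner x (\<i> *\<^sub>C (y::'h::complex_hilbert_space)))"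
  by (simp add: cinner_scaleC_right)

lemma Re_cinner_eqI:
  fixes x y :: "'h::complex_hilbert_space"
  assumes "\<And>z. Re (cinner x z) = Re (cinner y z)"
  shows "x = y"
proof -
  have "Re (cinner (x - y) (x - y)) = 0"
    using assms by (simp only: cinner_diff_left minus_complex.sel right_minus_eq)
  then show ?thesis by (simp add: Re_cinner_self)
qed

text \<open>For positive \<open>d\<close>, evaluate at the vertex \<open>t = - b / d\<close>; for
  \<open>d = 0\<close> an affine function that is nonnegative everywhere is constant.\<close>

lemma nonneg_quadratic_discriminant:
  fixes a b d :: real
  assumes nonneg: "\<And>t. 0 \<le> a + 2 * t * b + t\<^sup>2 * d" and "0 \<le> d"
  shows "b\<^sup>2 \<le> a * d"
proof (cases "d = 0")
  case True
  have "b = 0"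
  proof (rule ccontr)
    assume b: "b \<noteq> 0"
    \<comment> \<open>This \<open>t\<close> is chosen so that the affine function takes the value
      -1.\<close>
    have "2 * (- (a + 1) / (2 * b)) * b = - (a + 1)" using b by simp
    with nonneg[of "- (a + 1) / (2 * b)"] True show False by simp
  qed
  with True show ?thesis by simp
next
  case False
  with assms have d: "d > 0" by simp
  have "0 \<le> a + 2 * (- b / d) * b + (- b / d)\<^sup>2 * d" by (rule nonneg)
  also have "\<dots> = a - b\<^sup>2 / d" using d by (simp add: power2_eq_square field_simps)
  finally show ?thesis using d by (simp add: field_simps)
qed

text \<open>The form at \<open>x + t *\<^sub>R y\<close> is a nonnegative quadratic in
  \<open>t\<close>. The identity operator gives the usual inequality; positive operators give the
  norm estimates below.\<close>

lemma Re_cinner_Cauchy_Schwarz_psd: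
  fixes T :: "'h::complex_hilbert_space \<Rightarrow>\<^sub>L 'h"
  assumes sym: "\<And>x y. Re (cinner x (T y)) = Re (cinner (T x) y)"
    and psd: "\<And>x. 0 \<le> Re (cinner x (T x))"
  shows "(Re (cinner x (T y)))\<^sup>2 \<le> Re (cinner x (T x)) * Re (cinner y (T y))"
proof (rule nonneg_quadratic_discriminant)
  fix t :: real
  have "Re (cinner y (T x)) = Re (cinner x (T y))"
    using sym[of x y] Re_cinner_commute by metis
  then have "Re (cinner (x + t *\<^sub>R y) (T (x + t *\<^sub>R y)))
      = Re (cinner x (T x)) + 2 * t * Re (cinner x (T y)) + t\<^sup>2 * Re (cinner y (T y))"
    by (simp add: blinfun.add_right blinfun.scaleR_right cinner_simps power2_eq_square
        algebra_simps)
  then show "0 \<le> Re (cinner x (T x)) + 2 * t * Re (cinner x (T y)) + t\<^sup>2 * Re (cinner y (T y))"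
    using psd by metis
qed (rule psd)

lemma Re_cinner_le: "\<bar>Re (cinner x (y::'h::complex_hilbert_space))\<bar> \<le> norm x * norm y"
proof -
  have "(Re (cinner x y))\<^sup>2 \<le> (norm x * norm y)\<^sup>2"
    using Re_cinner_Cauchy_Schwarz_psd[of id_blinfun x y]
    by (simp add: Re_cinner_self power_mult_distrib)
  then show ?thesis by (simp add: abs_le_square_iff[symmetric])
qed

lemma bounded_bilinear_Re_cinner:
  "bounded_bilinear (\<lambda>x y::'h::complex_hilbert_space. Re (cinner x y))"
  by unfold_locales
    (auto simp: cinner_simps intro!: exI[of _ 1] Re_cinner_le)

text \<open>The representing vector is the minimiser of \<open>\<parallel>x\<parallel>\<^sup>2 / 2 - \<psi> x\<close>; minimising sequences are Cauchy by
  the parallelogram law.\<close>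

lemma Riesz_representation:
  fixes \<psi> :: "'h::complex_hilbert_space \<Rightarrow> real"
  assumes \<psi>: "bounded_linear \<psi>"
  shows "\<exists>z. \<forall>y. Re (cinner z y) = \<psi> y"
proof -
  interpret \<psi>: bounded_linear \<psi> by (rule \<psi>)
  obtain K where K: "\<And>x. \<bar>\<psi> x\<bar> \<le> norm x * K" using \<psi>.bounded by auto
  define J where "J x = (norm x)\<^sup>2 / 2 - \<psi> x" for x
  \<comment> \<open>Complete the square in \<open>norm x\<close>.\<close>
  have lower: "- (K\<^sup>2) / 2 \<le> J x" for x
  proof -
    have "\<psi> x \<le> norm x * K" using K[of x] by linarith
    moreover have "0 \<le> (norm x - K)\<^sup>2" by simp
    ultimately show ?thesis by (simp add: J_def power2_diff)
  qed
  define m where "m = Inf (range J)"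
  have bdd: "bdd_below (range J)" using lower by (intro bdd_belowI) auto
  have m_le: "m \<le> J x" for x unfolding m_def by (rule cInf_lower[OF _ bdd]) simp
  define r where "r n = inverse (real (Suc n))" for n
  have "\<exists>x. J x < m + r n" for n
  proof -
    have "Inf (range J) < m + r n" by (simp add: m_def r_def)
    then show ?thesis using cInf_lessD[of "range J"] by fastforce
  qed
  then obtain u where u: "\<And>n. J (u n) < m + r n" by metis
  have midpoint: "J x + J y = 2 * J ((1/2) *\<^sub>R (x + y)) + (norm (x - y))\<^sup>2 / 4" for x y
  proof -
    have "Re (cinner y x) = Re (cinner x y)" by (rule Re_cinner_commute)
    then show ?thesis
      unfolding J_def Re_cinner_self[symmetric]
      by (simp add: cinner_simps \<psi>.scaleR \<psi>.add field_simps)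
  qed
  \<comment> \<open>The midpoint of \<open>u i\<close> and \<open>u j\<close> has value at least
    \<open>m\<close>, so the parallelogram defect is controlled by the excesses over
    \<open>m\<close>.\<close>
  have cauchy_bound: "(norm (u i - u j))\<^sup>2 \<le> 4 * (r i + r j)" for i j
  proof -
    have "d \<le> 4 * (p + q)" if "a + b = 2 * e + d / 4" "m \<le> e" "a < m + p" "b < m + q"
      for a b d e p q :: real using that by simp
    from this[OF midpoint m_le u u] show ?thesis .
  qed
  have "Cauchy u"
  proof (rule CauchyI)
    fix e :: real assume e: "0 < e"
    obtain N where N: "r N < e\<^sup>2 / 8"
      using reals_Archimedean[of "e\<^sup>2/8"] e by (auto simp: r_def)
    have "norm (u i - u j) < e" if "i \<ge> N" "j \<ge> N" for i j
    proof (rule power2_less_imp_less)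
      have "r i \<le> r N" "r j \<le> r N"
        using that by (auto simp: r_def intro!: le_imp_inverse_le)
      then have "4 * (r i + r j) < e\<^sup>2" using N by simp
      then show "(norm (u i - u j))\<^sup>2 < e\<^sup>2" by (rule le_less_trans[OF cauchy_bound])
    qed (use e in simp)
    then show "\<exists>M. \<forall>m\<ge>M. \<forall>n\<ge>M. norm (u m - u n) < e" by blast
  qed
  then obtain z where z: "u \<longlonglongrightarrow> z" using convergent_eq_Cauchy convergent_def by blast
  have "(\<lambda>n. J (u n)) \<longlonglongrightarrow> J z"
    unfolding J_def by (intro tendsto_intros z \<psi>.tendsto) simp
  moreover have "(\<lambda>n. m + r n) \<longlonglongrightarrow> m + 0"
    unfolding r_def by (intro tendsto_intros LIMSEQ_inverse_real_of_nat)
  ultimately have "J z \<le> m + 0"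
    by (rule LIMSEQ_le) (use u less_imp_le in blast)
  then have min: "J z \<le> J y" for y using m_le[of y] by simp
  have "Re (cinner z y) = \<psi> y" for y
  proof -
    \<comment> \<open>First variation at the minimiser:
      \<open>2 * (J (z + t *\<^sub>R y) - J z)\<close> is a nonnegative quadratic in
      \<open>t\<close> without constant term, so its linear coefficient vanishes.\<close>
    have "(Re (cinner z y) - \<psi> y)\<^sup>2 \<le> 0 * (norm y)\<^sup>2"
    proof (rule nonneg_quadratic_discriminant)
      fix t :: real
      have "Re (cinner y z) = Re (cinner z y)" by (rule Re_cinner_commute)
      then have "2 * (J (z + t *\<^sub>R y) - J z) = 0 + 2 * t * (Re (cinner z y) - \<psi> y) + t\<^sup>2 * (norm y)\<^sup>2"
        unfolding J_def Re_cinner_self[symmetric]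
        by (simp add: cinner_simps \<psi>.scaleR \<psi>.add field_simps power2_eq_square)
      then show "0 \<le> 0 + 2 * t * (Re (cinner z y) - \<psi> y) + t\<^sup>2 * (norm y)\<^sup>2"
        using min[of "z + t *\<^sub>R y"] by (metis diff_ge_0_iff_ge mult_nonneg_nonneg zero_le_numeral)
    qed simp
    then show ?thesis by simp
  qed
  then show ?thesis by blast
qed

section \<open>Adjoints and positive operators\<close>

lemma compose_assoc: "(a o\<^sub>L b) o\<^sub>L c = a o\<^sub>L (b o\<^sub>L c)"
  by (rule blinfun_eqI) simp

lemmas compose_add_left = bounded_bilinear.add_left[OF bounded_bilinear_blinfun_compose]
lemmas compose_add_right = bounded_bilinear.add_right[OF bounded_bilinear_blinfun_compose]
lemmas compose_diff_left = bounded_bilinear.diff_left[OF bounded_bilinear_blinfun_compose]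
lemmas compose_diff_right = bounded_bilinear.diff_right[OF bounded_bilinear_blinfun_compose]
lemmas compose_scaleR_left = bounded_bilinear.scaleR_left[OF bounded_bilinear_blinfun_compose]
lemmas compose_scaleR_right = bounded_bilinear.scaleR_right[OF bounded_bilinear_blinfun_compose]
lemmas compose_zero_left [simp] = bounded_bilinear.zero_left[OF bounded_bilinear_blinfun_compose]
lemmas compose_zero_right [simp] = bounded_bilinear.zero_right[OF bounded_bilinear_blinfun_compose]
lemmas tendsto_compose_op = bounded_bilinear.tendsto[OF bounded_bilinear_blinfun_compose]

lemma compose_id_left [simp]: "id_blinfun o\<^sub>L a = a"
  by (rule blinfun_eqI) simp

lemma compose_id_right [simp]: "a o\<^sub>L id_blinfun = a"
  by (rule blinfun_eqI) simp

lemmas compose_simps = compose_add_left compose_add_right compose_diff_left compose_diff_right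
  compose_scaleR_left compose_scaleR_right

lemma bounded_opsD: "T \<in> bounded_ops \<Longrightarrow> T (c *\<^sub>C x) = c *\<^sub>C T x"
  by (simp add: bounded_ops_def)

lemma bounded_ops_zero [simp]: "0 \<in> bounded_ops"
  by (simp add: bounded_ops_def bounded_linear.linear[OF bounded_linear_scaleC, THEN linear_0])

lemma bounded_ops_id [simp]: "id_blinfun \<in> bounded_ops"
  by (simp add: bounded_ops_def)

lemma bounded_ops_add [simp]: "S \<in> bounded_ops \<Longrightarrow> T \<in> bounded_ops \<Longrightarrow> S + T \<in> bounded_ops"
  by (simp add: bounded_ops_def blinfun.add_left scaleC_add_right)

lemma bounded_ops_scaleR [simp]: "T \<in> bounded_ops \<Longrightarrow> r *\<^sub>R T \<in> bounded_ops"
  by (simp add: bounded_ops_def blinfun.scaleR_left scaleR_scaleC scaleC_scaleC mult.commute)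

lemma bounded_ops_diff [simp]: "S \<in> bounded_ops \<Longrightarrow> T \<in> bounded_ops \<Longrightarrow> S - T \<in> bounded_ops"
  using bounded_ops_add[of S "(-1) *\<^sub>R T"] bounded_ops_scaleR[of T "-1"] by simp

lemma bounded_ops_compose [simp]:
  "S \<in> bounded_ops \<Longrightarrow> T \<in> bounded_ops \<Longrightarrow> S o\<^sub>L T \<in> bounded_ops"
  by (simp add: bounded_ops_def)

lemma bounded_ops_tendsto:
  assumes T: "T \<longlonglongrightarrow> L" and ops: "\<And>n. T n \<in> bounded_ops"
  shows "L \<in> bounded_ops"
  unfolding bounded_ops_def
proof (intro CollectI allI)
  fix c x
  have "(\<lambda>n. T n (c *\<^sub>C x)) \<longlonglongrightarrow> L (c *\<^sub>C x)"
    by (intro tendsto_intros T)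
  moreover have "(\<lambda>n. T n (c *\<^sub>C x)) \<longlonglongrightarrow> c *\<^sub>C L x"
    unfolding bounded_opsD[OF ops]
    by (intro bounded_linear.tendsto[OF bounded_linear_scaleC] tendsto_intros T)
  ultimately show "L (c *\<^sub>C x) = c *\<^sub>C L x" by (rule LIMSEQ_unique)
qed

text \<open>Since \<open>T\<close> commutes with multiplication by \<open>\<i>\<close>, the identity
  of real parts at \<open>\<i> *\<^sub>C y\<close> is the identity of imaginary parts at
  \<open>y\<close>.\<close>

lemma cinner_eqI_Re:
  assumes "T \<in> bounded_ops" "\<And>x y. Re (cinner (S x) y) = Re (cinner x (blinfun_apply T y))"
  shows "cinner (S x) y = cinner x (T y)"
proof (rule complex_eqI)
  show "Im (cinner (S x) y) = Im (cinner x (T y))"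
    unfolding Im_cinner assms(2) bounded_opsD[OF assms(1)] ..
qed (rule assms(2))

section \<open>Adjoints\<close>

lemma adj_eqI:
  assumes "\<And>x y. cinner (blinfun_apply S x) y = cinner x (blinfun_apply T y)"
  shows "adj T = S"
  unfolding adj_def
proof (rule the_equality)
  fix S' :: "'a \<Rightarrow>\<^sub>L 'a"
  assume S': "\<forall>x y. cinner (S' x) y = cinner x (T y)"
  show "S' = S"
  proof (rule blinfun_eqI)
    show "S' x = S x" for x by (rule Re_cinner_eqI) (simp add: assms S')
  qed
qed (use assms in blast)

text \<open>Riesz representation defines \<open>S\<close> pointwise. Linearity follows by testing
  against all vectors, boundedness by taking \<open>y = S x\<close> in the defining
  identity.\<close>

lemma adj_exists:
  fixes T :: "'h::complex_hilbert_space \<Rightarrow>\<^sub>L 'h"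
  assumes T: "T \<in> bounded_ops"
  shows "\<exists>S :: 'h \<Rightarrow>\<^sub>L 'h. \<forall>x y. cinner (S x) y = cinner x (T y)"
proof -
  have "\<exists>z. \<forall>y. Re (cinner z y) = Re (cinner x (T y))" for x
    by (intro Riesz_representation
        bounded_linear_compose[OF bounded_bilinear.bounded_linear_right[OF bounded_bilinear_Re_cinner]]
        blinfun.bounded_linear_right)
  then obtain S where S: "\<And>x y. Re (cinner (S x) y) = Re (cinner x (T y))" by metis
  have "bounded_linear S"
  proof (rule bounded_linear_intro)
    show "S (x + y) = S x + S y" for x y
      by (rule Re_cinner_eqI) (simp add: S cinner_simps)
    show "S (r *\<^sub>R x) = r *\<^sub>R S x" for r x
      by (rule Re_cinner_eqI) (simp add: S cinner_simps)
    fix x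
    have "(norm (S x))\<^sup>2 = Re (cinner x (T (S x)))" by (simp flip: Re_cinner_self S)
    also have "\<dots> \<le> norm x * norm (T (S x))" using Re_cinner_le[of x "T (S x)"] by simp
    also have "\<dots> \<le> norm x * (norm T * norm (S x))"
      by (intro mult_left_mono norm_blinfun) simp
    finally have "norm (S x) * norm (S x) \<le> (norm x * norm T) * norm (S x)"
      by (simp add: power2_eq_square mult_ac)
    then show "norm (S x) \<le> norm x * norm T"
      by (cases "norm (S x) = 0") auto
  qed
  then have "blinfun_apply (Blinfun S) = S" by (rule bounded_linear_Blinfun_apply)
  with cinner_eqI_Re[OF T S] show ?thesis by metis
qed

lemma cinner_adj_left:
  assumes "T \<in> bounded_ops"
  shows "cinner (adj T x) y = cinner x (T y)"
proof -
  obtain S where S: "\<And>x y. cinner (blinfun_apply S x) y = cinner x (T y)"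
    using adj_exists[OF assms] by blast
  with adj_eqI[of S T] show ?thesis by simp
qed

lemma cinner_adj_right: "T \<in> bounded_ops \<Longrightarrow> cinner x (adj T y) = cinner (T x) y"
  by (metis cinner_adj_left cinner_commute)

lemma adj_bounded_ops [simp]:
  assumes T: "T \<in> bounded_ops"
  shows "adj T \<in> bounded_ops"
  unfolding bounded_ops_def
proof (intro CollectI allI)
  show "adj T (c *\<^sub>C x) = c *\<^sub>C adj T x" for c x
    by (rule Re_cinner_eqI) (simp add: cinner_adj_left T cinner_scaleC_left)
qed

lemma adj_adj [simp]: "T \<in> bounded_ops \<Longrightarrow> adj (adj T) = T"
  by (rule adj_eqI) (simp add: cinner_adj_right)

lemma adj_zero [simp]: "adj 0 = 0"
  by (rule adj_eqI) simp

lemma adj_id [simp]: "adj id_blinfun = id_blinfun"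
  by (rule adj_eqI) simp

lemma adj_add: "S \<in> bounded_ops \<Longrightarrow> T \<in> bounded_ops \<Longrightarrow> adj (S + T) = adj S + adj T"
  by (rule adj_eqI) (simp add: cinner_adj_left cinner_simps blinfun.add_left)

lemma adj_diff: "S \<in> bounded_ops \<Longrightarrow> T \<in> bounded_ops \<Longrightarrow> adj (S - T) = adj S - adj T"
  by (rule adj_eqI) (simp add: cinner_adj_left cinner_simps blinfun.diff_left)

lemma adj_scaleR: "T \<in> bounded_ops \<Longrightarrow> adj (r *\<^sub>R T) = r *\<^sub>R adj T"
  by (rule adj_eqI) (simp add: cinner_adj_left cinner_simps blinfun.scaleR_left)

lemma adj_compose: "S \<in> bounded_ops \<Longrightarrow> T \<in> bounded_ops \<Longrightarrow> adj (S o\<^sub>L T) = adj T o\<^sub>L adj S"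
  by (rule adj_eqI) (simp add: cinner_adj_left)

lemmas adj_simps = adj_add adj_diff adj_scaleR adj_compose

lemma norm_adj_le:
  assumes T: "T \<in> bounded_ops"
  shows "norm (adj T) \<le> norm T"
proof (rule norm_blinfun_bound)
  fix x
  have "(norm (adj T x))\<^sup>2 = Re (cinner x (T (adj T x)))"
    by (simp flip: Re_cinner_self cinner_adj_left[OF T])
  also have "\<dots> \<le> norm x * norm (T (adj T x))" using Re_cinner_le[of x "T (adj T x)"] by simp
  also have "\<dots> \<le> norm x * (norm T * norm (adj T x))"
    by (intro mult_left_mono norm_blinfun) simp
  finally have "norm (adj T x) * norm (adj T x) \<le> (norm T * norm x) * norm (adj T x)"
    by (simp add: power2_eq_square mult_ac)
  then show "norm (adj T x) \<le> norm T * norm x"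
    by (cases "norm (adj T x) = 0") auto
qed simp

text \<open>Taking adjoints is additive and does not increase the norm, hence it is
  continuous.\<close>

lemma tendsto_adj:
  assumes T: "T \<longlonglongrightarrow> L" and ops: "\<And>n. T n \<in> bounded_ops"
  shows "(\<lambda>n. adj (T n)) \<longlonglongrightarrow> adj L"
proof -
  note L = bounded_ops_tendsto[OF T ops]
  have lim: "(\<lambda>n. norm (T n - L)) \<longlonglongrightarrow> 0" using T by (simp add: LIM_zero tendsto_norm_zero)
  have "\<forall>\<^sub>F n in sequentially. norm (adj (T n) - adj L) \<le> norm (T n - L)"
    using norm_adj_le[of "T n - L" for n] L ops by (simp add: adj_diff)
  then have "(\<lambda>n. adj (T n) - adj L) \<longlonglongrightarrow> 0" using lim by (rule Lim_null_comparison)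
  then show ?thesis by (simp add: LIM_zero_iff)
qed

text \<open>The quadratic form of \<open>adj T o\<^sub>L T\<close> at \<open>x\<close> is the square
  of the norm of \<open>T x\<close>. This is the basic cancellation rule for everything that
  follows.\<close>

lemma adj_compose_self_eq_zero:
  assumes "T \<in> bounded_ops" "adj T o\<^sub>L T = 0"
  shows "T = 0"
proof (rule blinfun_eqI)
  fix x
  have "(norm (T x))\<^sup>2 = Re (cinner ((adj T o\<^sub>L T) x) x)"
    using assms(1) by (simp add: Re_cinner_self cinner_adj_left)
  then show "T x = blinfun_apply 0 x" by (simp add: assms(2))
qed

section \<open>Positive operators\<close>

lemma positive_op_bounded_ops [simp]: "positive_op P \<Longrightarrow> P \<in> bounded_ops"
  by (simp add: positive_op_def)

lemma positive_op_Re: "positive_op P \<Longrightarrow> 0 \<le> Re (cinner x (P x))"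
  by (simp add: positive_op_def)

lemma positive_opI:
  assumes "P \<in> bounded_ops" "adj P = P" "\<And>x. 0 \<le> Re (cinner x (P x))"
  shows "positive_op P"
proof -
  have "cinner x (P x) = cnj (cinner x (P x))" for x
    using cinner_adj_left[OF assms(1), of x x] assms(2) cinner_commute[of x "P x"] by simp
  then show ?thesis
    using assms by (simp add: positive_op_def complex_is_Real_iff complex_eq_iff)
qed

text \<open>Polarisation: a complex-linear operator with real quadratic form is
  self-adjoint.\<close>

lemma positive_op_adj [simp]:
  assumes P: "positive_op P"
  shows "adj P = P"
proof (rule adj_eqI)
  note Pops = positive_op_bounded_ops[OF P]
  have real: "cinner x (P x) = cinner (P x) x" for x
    using P cinner_commute[of "P x" x] Reals_cnj_iff unfolding positive_op_def by metis
  have sum: "cinner x (P y) + cinner y (P x) = cinner (P x) y + cinner (P y) x" for x y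
    using real[of "x + y"] real[of x] real[of y]
    by (simp add: cinner_simps blinfun.add_right algebra_simps)
  show "cinner (P x) y = cinner x (P y)" for x y
  proof -
    \<comment> \<open>Replacing \<open>y\<close> by \<open>\<i> *\<^sub>C y\<close> turns the sum of
      the two mixed terms into their difference; adding both relations isolates one term.\<close>
    have "\<i> * (cinner x (P y) - cinner y (P x)) = \<i> * (cinner (P x) y - cinner (P y) x)"
      using sum[of x "\<i> *\<^sub>C y"]
      by (simp add: bounded_opsD[OF Pops] cinner_scaleC_left cinner_scaleC_right algebra_simps)
    then have "cinner x (P y) - cinner y (P x) = cinner (P x) y - cinner (P y) x"
      by (simp only: mult_cancel_left complex_i_not_zero simp_thms)
    then show ?thesis using sum[of x y] by (auto simp: complex_eq_iff)
  qed
qed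

lemma positive_op_zero [simp]: "positive_op 0"
  by (simp add: positive_op_def)

lemma positive_op_scaleR: "positive_op P \<Longrightarrow> 0 \<le> r \<Longrightarrow> positive_op (r *\<^sub>R P)"
  by (simp add: positive_op_def blinfun.scaleR_left cinner_simps)

lemma positive_op_conj:
  assumes P: "positive_op P" and T: "T \<in> bounded_ops"
  shows "positive_op (adj T o\<^sub>L P o\<^sub>L T)"
proof -
  have "cinner x ((adj T o\<^sub>L P o\<^sub>L T) x) = cinner (T x) (P (T x))" for x
    using T by (simp add: cinner_adj_right)
  with assms show ?thesis unfolding positive_op_def[of "adj T o\<^sub>L P o\<^sub>L T"]
    by (simp add: positive_op_def)
qed

text \<open>Two nonnegative forms with sum zero both vanish, and Cauchy-Schwarz for the form of
  \<open>P\<close> at \<open>P x\<close> and \<open>x\<close> then gives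
  \<open>P x = 0\<close>.\<close>

lemma positive_op_antisym:
  assumes "positive_op P" "positive_op Q" "P + Q = 0"
  shows "P = 0"
proof (rule blinfun_eqI)
  fix x
  have sym: "Re (cinner u (P v)) = Re (cinner (P u) v)" for u v
    using assms(1) cinner_adj_left[of P] by simp
  have sum: "Re (cinner y (P y)) + Re (cinner y (Q y)) = Re (cinner y ((P + Q) y))" for y
    by (simp add: blinfun.add_left cinner_simps)
  have zero: "Re (cinner y (P y)) = 0" for y
    using sum[of y] positive_op_Re[OF assms(1), of y] positive_op_Re[OF assms(2), of y]
    by (simp add: assms(3) add_nonneg_eq_0_iff)
  show "P x = blinfun_apply 0 x"
    using Re_cinner_Cauchy_Schwarz_psd[OF sym, of "P x" x] zero
    by (simp add: Re_cinner_self)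
qed

text \<open>This is the inequality P^2 <= k P. Apply Cauchy-Schwarz for the form of \<open>P\<close>
  to \<open>P x\<close> and \<open>x\<close>, bound the form at \<open>P x\<close> by
  \<open>k\<close>, and cancel the squared norm of \<open>P x\<close>.\<close>

lemma positive_op_norm_bound:
  assumes P: "positive_op P" and bound: "\<And>x. Re (cinner x (P x)) \<le> k * (norm x)\<^sup>2"
  shows "(norm (P x))\<^sup>2 \<le> k * Re (cinner x (P x))"
proof (cases "P x = 0")
  case False
  have sym: "Re (cinner u (P v)) = Re (cinner (P u) v)" for u v
    using P cinner_adj_left[of P] by simp
  have "((norm (P x))\<^sup>2)\<^sup>2 \<le> Re (cinner (P x) (P (P x))) * Re (cinner x (P x))"
    using Re_cinner_Cauchy_Schwarz_psd[OF sym positive_op_Re[OF P], of "P x" x]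
    by (simp add: Re_cinner_self)
  also have "\<dots> \<le> (k * (norm (P x))\<^sup>2) * Re (cinner x (P x))"
    by (intro mult_right_mono bound positive_op_Re[OF P])
  finally have "(norm (P x))\<^sup>2 * (norm (P x))\<^sup>2 \<le> (k * Re (cinner x (P x))) * (norm (P x))\<^sup>2"
    by (simp only: mult_ac power2_eq_square)
  moreover have "0 < (norm (P x))\<^sup>2" using False by simp
  ultimately show ?thesis by (rule mult_right_le_imp_le)
next
  case True
  then show ?thesis by simp
qed

lemma Re_cinner_op_le: "Re (cinner x (blinfun_apply T x)) \<le> norm T * (norm x)\<^sup>2"
proof -
  have "Re (cinner x (T x)) \<le> norm x * norm (T x)" using Re_cinner_le[of x "T x"] by simp
  also have "\<dots> \<le> norm x * (norm T * norm x)" by (intro mult_left_mono norm_blinfun) simp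
  finally show ?thesis by (simp add: power2_eq_square mult_ac)
qed

lemma positive_op_norm_le:
  assumes P: "positive_op P" and bound: "\<And>x. Re (cinner x (P x)) \<le> k * (norm x)\<^sup>2" and "0 \<le> k"
  shows "norm P \<le> k"
proof (rule norm_blinfun_bound)
  fix x
  have "(norm (P x))\<^sup>2 \<le> k * Re (cinner x (P x))" by (rule positive_op_norm_bound[OF P bound])
  also have "\<dots> \<le> k * (k * (norm x)\<^sup>2)" by (intro mult_left_mono bound \<open>0 \<le> k\<close>)
  finally have "(norm (P x))\<^sup>2 \<le> (k * norm x)\<^sup>2" by (simp add: power2_eq_square mult_ac)
  then show "norm (P x) \<le> k * norm x" by (rule power2_le_imp_le) (simp add: \<open>0 \<le> k\<close>)
qed (rule \<open>0 \<le> k\<close>)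

section \<open>Square roots and absolute values\<close>

text \<open>If \<open>Y\<close> is a fixed point of \<open>Y \<mapsto> (A + Y\<^sup>2) / 2\<close>, then \<open>(1 - Y)\<^sup>2 = 1 - A\<close>. The iteration starting
  at \<open>0\<close> converges in norm for \<open>\<parallel>A\<parallel> \<le> 1\<close>, since its increments are dominated by those of the scalar
  iteration for \<open>A = 1\<close>.\<close>

primrec sqrt_iteration :: "('h::complex_hilbert_space \<Rightarrow>\<^sub>L 'h) \<Rightarrow> nat \<Rightarrow> ('h \<Rightarrow>\<^sub>L 'h)" where
  "sqrt_iteration A 0 = 0"
| "sqrt_iteration A (Suc n) = (1/2) *\<^sub>R (A + (sqrt_iteration A n o\<^sub>L sqrt_iteration A n))"

primrec sqrt_majorant :: "nat \<Rightarrow> real" where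
  "sqrt_majorant 0 = 0"
| "sqrt_majorant (Suc n) = (1 + (sqrt_majorant n)\<^sup>2) / 2"

lemma sqrt_majorant_bounds: "0 \<le> sqrt_majorant n \<and> sqrt_majorant n \<le> 1"
  by (induction n) (auto intro: power_le_one)

lemma incseq_sqrt_majorant: "incseq sqrt_majorant"
proof (rule incseq_SucI)
  fix n
  have "0 \<le> (1 - sqrt_majorant n)\<^sup>2" by simp
  then show "sqrt_majorant n \<le> sqrt_majorant (Suc n)" by (simp add: power2_diff)
qed

lemma Cauchy_sqrt_majorant: "Cauchy sqrt_majorant"
  using incseq_convergent[OF incseq_sqrt_majorant, of 1] sqrt_majorant_bounds
  by (metis LIMSEQ_imp_Cauchy)

lemma norm_sqrt_iteration:
  assumes A: "norm A \<le> 1"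
  shows "norm (sqrt_iteration A n) \<le> sqrt_majorant n"
proof (induction n)
  case (Suc n)
  let ?Y = "sqrt_iteration A n"
  have "norm (?Y o\<^sub>L ?Y) \<le> norm ?Y * norm ?Y" by (rule norm_blinfun_compose)
  also have "\<dots> \<le> sqrt_majorant n * sqrt_majorant n"
    using Suc sqrt_majorant_bounds by (intro mult_mono) auto
  finally have "norm (A + (?Y o\<^sub>L ?Y)) \<le> 1 + (sqrt_majorant n)\<^sup>2"
    unfolding power2_eq_square using A by (intro norm_triangle_mono)
  then show ?case by simp
qed simp

lemma norm_sqrt_iteration_step:
  assumes A: "norm A \<le> 1"
  shows "norm (sqrt_iteration A (Suc n) - sqrt_iteration A n) \<le> sqrt_majorant (Suc n) - sqrt_majorant n"
proof (induction n)
  case 0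
  then show ?case using A by simp
next
  case (Suc n)
  let ?Y = "sqrt_iteration A" and ?y = sqrt_majorant
  let ?d = "?Y (Suc n) - ?Y n" and ?e = "?y (Suc n) - ?y n"
  \<comment> \<open>A difference of squares, split as Y' d + d Y with d = Y' - Y, an identity valid
    in any ring.\<close>
  have "?Y (Suc (Suc n)) - ?Y (Suc n) = (1/2) *\<^sub>R ((?Y (Suc n) o\<^sub>L ?d) + (?d o\<^sub>L ?Y n))"
    unfolding sqrt_iteration.simps(2)[of A "Suc n"]
    by (subst (2) sqrt_iteration.simps(2)) (simp add: compose_simps algebra_simps del: sqrt_iteration.simps)
  moreover have "norm (?Y (Suc n) o\<^sub>L ?d) \<le> ?y (Suc n) * ?e"
    using norm_sqrt_iteration[OF A, of "Suc n"] Suc sqrt_majorant_bounds[of "Suc n"]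
    by (intro order_trans[OF norm_blinfun_compose] mult_mono) auto
  moreover have "norm (?d o\<^sub>L ?Y n) \<le> ?e * ?y n"
    using norm_sqrt_iteration[OF A, of n] Suc incseq_SucD[OF incseq_sqrt_majorant, of n]
    by (intro order_trans[OF norm_blinfun_compose] mult_mono) auto
  ultimately have "norm (?Y (Suc (Suc n)) - ?Y (Suc n)) \<le> (?y (Suc n) * ?e + ?e * ?y n) / 2"
    using norm_triangle_ineq[of "?Y (Suc n) o\<^sub>L ?d" "?d o\<^sub>L ?Y n"]
    by (simp del: sqrt_iteration.simps sqrt_majorant.simps)
  also have "\<dots> = ((?y (Suc n))\<^sup>2 - (?y n)\<^sup>2) / 2"
    by (simp add: power2_eq_square algebra_simps del: sqrt_majorant.simps)
  also have "\<dots> = ?y (Suc (Suc n)) - ?y (Suc n)"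
    unfolding sqrt_majorant.simps(2)[of "Suc n"]
    by (subst (2) sqrt_majorant.simps(2)) (simp add: field_simps del: sqrt_majorant.simps)
  finally show ?case .
qed

lemma norm_sqrt_iteration_diff:
  assumes A: "norm A \<le> 1" and "n \<le> m"
  shows "norm (sqrt_iteration A m - sqrt_iteration A n) \<le> sqrt_majorant m - sqrt_majorant n"
  using \<open>n \<le> m\<close>
proof (induction m rule: dec_induct)
  case (step m)
  have "norm (sqrt_iteration A (Suc m) - sqrt_iteration A n)
      \<le> norm (sqrt_iteration A (Suc m) - sqrt_iteration A m) + norm (sqrt_iteration A m - sqrt_iteration A n)"
    using norm_triangle_ineq[of "sqrt_iteration A (Suc m) - sqrt_iteration A m"
        "sqrt_iteration A m - sqrt_iteration A n"] by (simp del: sqrt_iteration.simps)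
  then show ?case using norm_sqrt_iteration_step[OF A, of m] step.IH by linarith
qed simp

lemma convergent_sqrt_iteration:
  assumes A: "norm A \<le> 1"
  shows "convergent (sqrt_iteration A)"
proof -
  have "Cauchy (sqrt_iteration A)"
  proof (rule CauchyI)
    fix e :: real assume "0 < e"
    then obtain M where M: "\<And>m n. m \<ge> M \<Longrightarrow> n \<ge> M \<Longrightarrow> norm (sqrt_majorant m - sqrt_majorant n) < e"
      using CauchyD[OF Cauchy_sqrt_majorant] by metis
    have "norm (sqrt_iteration A m - sqrt_iteration A n) < e" if "m \<ge> M" "n \<ge> M" for m n
    proof (cases "n \<le> m")
      case True
      with norm_sqrt_iteration_diff[OF A True] M[OF that] show ?thesis by auto
    next
      case False
      then have "m \<le> n" by simp
      with norm_sqrt_iteration_diff[OF A this] M[OF that(2,1)] show ?thesis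
        by (subst norm_minus_commute) auto
    qed
    then show "\<exists>M. \<forall>m\<ge>M. \<forall>n\<ge>M. norm (sqrt_iteration A m - sqrt_iteration A n) < e" by blast
  qed
  then show ?thesis by (simp add: Cauchy_convergent_iff)
qed

lemma sqrt_iteration_commute:
  assumes "C o\<^sub>L A = A o\<^sub>L C"
  shows "C o\<^sub>L sqrt_iteration A n = sqrt_iteration A n o\<^sub>L C"
proof (induction n)
  case (Suc n)
  have "C o\<^sub>L (sqrt_iteration A n o\<^sub>L sqrt_iteration A n) = (sqrt_iteration A n o\<^sub>L sqrt_iteration A n) o\<^sub>L C"
    by (metis Suc compose_assoc)
  with assms show ?case by (simp add: compose_simps)
qed simp

lemma sqrt_iteration_selfadjoint:
  assumes "A \<in> bounded_ops" "adj A = A"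
  shows "sqrt_iteration A n \<in> bounded_ops \<and> adj (sqrt_iteration A n) = sqrt_iteration A n"
  by (induction n) (use assms in \<open>auto simp: adj_simps\<close>)

text \<open>All properties pass from the iterates to their norm limit. The commutation clause is
  carried along for the uniqueness of square roots.\<close>

lemma sqrt_fixed_point:
  assumes A: "norm A \<le> 1" "A \<in> bounded_ops" "adj A = A"
  shows "\<exists>Y. Y \<in> bounded_ops \<and> adj Y = Y \<and> norm Y \<le> 1 \<and> (Y o\<^sub>L Y) = 2 *\<^sub>R Y - A \<and>
    (\<forall>C. C o\<^sub>L A = A o\<^sub>L C \<longrightarrow> C o\<^sub>L Y = Y o\<^sub>L C)"
proof -
  obtain Y where Y: "sqrt_iteration A \<longlonglongrightarrow> Y"
    using convergent_sqrt_iteration[OF A(1)] convergent_def by blast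
  have ops: "sqrt_iteration A n \<in> bounded_ops" for n using sqrt_iteration_selfadjoint[OF A(2,3)] by blast
  have "Y \<in> bounded_ops" by (rule bounded_ops_tendsto[OF Y ops])
  moreover have "adj Y = Y"
    using tendsto_adj[OF Y ops] sqrt_iteration_selfadjoint[OF A(2,3)] Y LIMSEQ_unique by simp
  moreover have "norm Y \<le> 1"
    using norm_sqrt_iteration[OF A(1)] sqrt_majorant_bounds
    by (intro LIMSEQ_le_const2[OF tendsto_norm[OF Y]]) (meson order_trans)
  moreover have "(Y o\<^sub>L Y) = 2 *\<^sub>R Y - A"
  proof -
    have "(\<lambda>n. sqrt_iteration A (Suc n)) \<longlonglongrightarrow> (1/2) *\<^sub>R (A + (Y o\<^sub>L Y))"
      unfolding sqrt_iteration.simps by (intro tendsto_intros tendsto_compose_op Y)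
    then have eq: "(1/2) *\<^sub>R (A + (Y o\<^sub>L Y)) = Y" using LIMSEQ_Suc[OF Y] LIMSEQ_unique by blast
    have "A + (Y o\<^sub>L Y) = 2 *\<^sub>R ((1/2) *\<^sub>R (A + (Y o\<^sub>L Y)))" by simp
    then show ?thesis unfolding eq by (simp add: algebra_simps)
  qed
  moreover have "C o\<^sub>L Y = Y o\<^sub>L C" if C: "C o\<^sub>L A = A o\<^sub>L C" for C
  proof (rule LIMSEQ_unique)
    show "(\<lambda>n. C o\<^sub>L sqrt_iteration A n) \<longlonglongrightarrow> (C o\<^sub>L Y)" by (intro tendsto_compose_op tendsto_const Y)
    show "(\<lambda>n. C o\<^sub>L sqrt_iteration A n) \<longlonglongrightarrow> (Y o\<^sub>L C)"
      unfolding sqrt_iteration_commute[OF C] by (intro tendsto_compose_op tendsto_const Y)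
  qed
  ultimately show ?thesis by blast
qed

lemma positive_op_sqrt_exists:
  assumes P: "positive_op P"
  shows "\<exists>S. positive_op S \<and> (S o\<^sub>L S) = P \<and> (\<forall>C. C o\<^sub>L P = P o\<^sub>L C \<longrightarrow> C o\<^sub>L S = S o\<^sub>L C)"
proof (cases "P = 0")
  case True
  then show ?thesis by (intro exI[of _ 0]) simp
next
  case False
  define s where "s = norm P"
  have s: "s > 0" using False by (simp add: s_def)
  \<comment> \<open>Scaling by the norm puts \<open>A\<close> between 0 and 1, and a fixed point
    \<open>Y\<close> satisfies (1 - Y)^2 = P/s.\<close>
  define A where "A = id_blinfun - (1/s) *\<^sub>R P"
  have A: "A \<in> bounded_ops" "adj A = A" using P by (simp_all add: A_def adj_simps)
  have form: "Re (cinner x (A x)) = (norm x)\<^sup>2 - Re (cinner x (P x)) / s" for x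
    by (simp add: A_def blinfun.diff_left blinfun.scaleR_left cinner_simps Re_cinner_self)
  have "positive_op A"
  proof (rule positive_opI[OF A])
    fix x
    have "Re (cinner x (P x)) / s \<le> (norm x)\<^sup>2"
      using Re_cinner_op_le[of x P] s by (simp add: s_def field_simps)
    then show "0 \<le> Re (cinner x (A x))" by (simp add: form)
  qed
  moreover have "Re (cinner x (A x)) \<le> 1 * (norm x)\<^sup>2" for x
    using s positive_op_Re[OF P, of x] by (simp add: form)
  ultimately have "norm A \<le> 1" by (rule positive_op_norm_le) simp
  then obtain Y where Y: "Y \<in> bounded_ops" "adj Y = Y" "norm Y \<le> 1" "(Y o\<^sub>L Y) = 2 *\<^sub>R Y - A"
    and Y_comm: "\<And>C. C o\<^sub>L A = A o\<^sub>L C \<Longrightarrow> C o\<^sub>L Y = Y o\<^sub>L C"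
    using sqrt_fixed_point A by blast
  define S where "S = sqrt s *\<^sub>R (id_blinfun - Y)"
  have "positive_op (id_blinfun - Y)"
  proof (rule positive_opI)
    fix x
    have "Re (cinner x (Y x)) \<le> norm Y * (norm x)\<^sup>2" by (rule Re_cinner_op_le)
    also have "\<dots> \<le> 1 * (norm x)\<^sup>2" by (intro mult_right_mono Y) simp
    finally show "0 \<le> Re (cinner x ((id_blinfun - Y) x))"
      by (simp add: blinfun.diff_left cinner_simps Re_cinner_self)
  qed (use Y in \<open>simp_all add: adj_simps\<close>)
  then have "positive_op S" unfolding S_def by (rule positive_op_scaleR) (use s in simp)
  moreover have "(S o\<^sub>L S) = P"
  proof -
    have "(S o\<^sub>L S) = s *\<^sub>R (id_blinfun - Y - Y + (Y o\<^sub>L Y))"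
      using s by (simp add: S_def compose_simps scaleR_diff_right scaleR_add_right)
    also have "\<dots> = s *\<^sub>R (id_blinfun - A)" by (simp add: Y(4) scaleR_2)
    also have "\<dots> = P" using s by (simp add: A_def)
    finally show ?thesis .
  qed
  moreover have "C o\<^sub>L S = S o\<^sub>L C" if "C o\<^sub>L P = P o\<^sub>L C" for C
    using Y_comm[of C] that by (simp add: S_def A_def compose_simps)
  ultimately show ?thesis by blast
qed

section \<open>Uniqueness of positive square roots\<close>

lemma positive_op_square: "positive_op P \<Longrightarrow> positive_op (P o\<^sub>L P)"
  using positive_op_conj[of id_blinfun P] positive_opI[of id_blinfun]
  by (simp add: Re_cinner_self)

lemma positive_op_adj_compose_self: "T \<in> bounded_ops \<Longrightarrow> positive_op (adj T o\<^sub>L T)"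
  using positive_op_conj[of id_blinfun T] positive_opI[of id_blinfun]
  by (simp add: Re_cinner_self)

lemma commuting_positive_sqrt_unique:
  assumes S: "positive_op S" and Q: "positive_op Q" and eq: "S o\<^sub>L S = Q o\<^sub>L Q"
    and comm: "Q o\<^sub>L S = S o\<^sub>L Q"
  shows "S = Q"
proof -
  \<comment> \<open>\<open>d S d + d Q d = d (S\<^sup>2 - Q\<^sup>2) = 0\<close>, so both summands vanish and hence \<open>d\<^sup>3 = 0\<close>.\<close>
  define d where "d = S - Q"
  have d: "d \<in> bounded_ops" "adj d = d" using S Q by (simp_all add: d_def adj_simps)
  have "(S + Q) o\<^sub>L d = 0" using eq comm by (simp add: d_def compose_simps)
  then have "(d o\<^sub>L S o\<^sub>L d) + (d o\<^sub>L Q o\<^sub>L d) = 0"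
    by (simp add: compose_assoc flip: compose_add_right compose_add_left)
  moreover have "positive_op (d o\<^sub>L S o\<^sub>L d)" "positive_op (d o\<^sub>L Q o\<^sub>L d)"
    using positive_op_conj[OF S d(1)] positive_op_conj[OF Q d(1)] d(2) by simp_all
  ultimately have "d o\<^sub>L S o\<^sub>L d = 0" "d o\<^sub>L Q o\<^sub>L d = 0"
    using positive_op_antisym add.commute by metis+
  then have "d o\<^sub>L (S - Q) o\<^sub>L d = 0" by (simp add: compose_simps)
  then have "d o\<^sub>L (d o\<^sub>L d) = 0" by (simp add: d_def compose_assoc)
  then have "adj (d o\<^sub>L d) o\<^sub>L (d o\<^sub>L d) = 0" using d by (simp add: adj_compose compose_assoc)
  then have "d o\<^sub>L d = 0" using d adj_compose_self_eq_zero[of "d o\<^sub>L d"] by simp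
  then have "d = 0" using d adj_compose_self_eq_zero[of d] by simp
  then show ?thesis by (simp add: d_def)
qed

text \<open>The constructed root \<open>S\<close> of the square of \<open>Q\<close> commutes with
  whatever commutes with that square, in particular with \<open>Q\<close>. Hence
  \<open>S = Q\<close>, and \<open>Q\<close> inherits the property.\<close>

lemma positive_sqrt_commute:
  assumes Q: "positive_op Q" and C: "C o\<^sub>L (Q o\<^sub>L Q) = (Q o\<^sub>L Q) o\<^sub>L C"
  shows "C o\<^sub>L Q = Q o\<^sub>L C"
proof -
  obtain S where S: "positive_op S" "(S o\<^sub>L S) = Q o\<^sub>L Q"
    and comm: "\<And>C. C o\<^sub>L (Q o\<^sub>L Q) = (Q o\<^sub>L Q) o\<^sub>L C \<Longrightarrow> C o\<^sub>L S = S o\<^sub>L C"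
    using positive_op_sqrt_exists[OF positive_op_square[OF Q]] by blast
  have "S = Q" by (rule commuting_positive_sqrt_unique[OF S(1) Q S(2) comm]) (simp add: compose_assoc)
  with comm[OF C] show ?thesis by simp
qed

text \<open>\<open>P\<close> commutes with its own square, which is that of \<open>Q\<close>, hence
  with \<open>Q\<close>; this reduces to the commuting case.\<close>

lemma positive_sqrt_unique:
  assumes "positive_op P" "positive_op Q" "P o\<^sub>L P = Q o\<^sub>L Q"
  shows "P = Q"
proof -
  have "P o\<^sub>L (Q o\<^sub>L Q) = (Q o\<^sub>L Q) o\<^sub>L P" using assms(3) by (metis compose_assoc)
  from positive_sqrt_commute[OF assms(2) this] show ?thesis
    using assms commuting_positive_sqrt_unique by metis
qed

section \<open>Absolute values\<close>

lemma abs_op_eqI: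
  assumes "positive_op P" "P o\<^sub>L P = adj T o\<^sub>L T"
  shows "abs_op T = P"
  unfolding abs_op_def
proof (rule the_equality)
  fix Q assume "positive_op Q \<and> Q o\<^sub>L Q = adj T o\<^sub>L T"
  then show "Q = P" using assms positive_sqrt_unique[of Q P] by simp
qed (use assms in simp)

lemma abs_op:
  assumes T: "T \<in> bounded_ops"
  shows positive_abs_op: "positive_op (abs_op T)"
    and abs_op_square: "abs_op T o\<^sub>L abs_op T = adj T o\<^sub>L T"
proof -
  obtain S where S: "positive_op S" "(S o\<^sub>L S) = adj T o\<^sub>L T"
    using positive_op_sqrt_exists[OF positive_op_adj_compose_self[OF T]] by blast
  with abs_op_eqI[OF S] show "positive_op (abs_op T)" "abs_op T o\<^sub>L abs_op T = adj T o\<^sub>L T" by simp_all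
qed

lemma abs_op_positive: "positive_op P \<Longrightarrow> abs_op P = P"
  by (rule abs_op_eqI) simp_all

lemma abs_op_scaleR:
  assumes "T \<in> bounded_ops" "0 \<le> r"
  shows "abs_op (r *\<^sub>R T) = r *\<^sub>R abs_op T"
  using assms by (intro abs_op_eqI positive_op_scaleR)
    (simp_all add: positive_abs_op abs_op_square compose_simps adj_simps)

text \<open>Only the squares \<open>adj (T n) o\<^sub>L T n\<close> are passed to the limit;
  uniqueness of the positive root does the rest.\<close>

lemma abs_op_tendsto_unique:
  assumes T: "T \<longlonglongrightarrow> L" and ops: "\<And>n. T n \<in> bounded_ops"
    and abs: "(\<lambda>n. abs_op (T n)) \<longlonglongrightarrow> P" and P: "positive_op P"
  shows "abs_op L = P"
proof (rule abs_op_eqI[OF P])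
  have "(\<lambda>n. abs_op (T n) o\<^sub>L abs_op (T n)) \<longlonglongrightarrow> (P o\<^sub>L P)" by (intro tendsto_compose_op abs)
  moreover have "(\<lambda>n. abs_op (T n) o\<^sub>L abs_op (T n)) \<longlonglongrightarrow> (adj L o\<^sub>L L)"
    unfolding abs_op_square[OF ops] by (intro tendsto_compose_op tendsto_adj T ops)
  ultimately show "P o\<^sub>L P = adj L o\<^sub>L L" by (rule LIMSEQ_unique)
qed

section \<open>Closure properties of C*-subalgebras\<close>

lemma scaleC_op_of_real: "scaleC_op (of_real r) T = r *\<^sub>R T"
  by (rule blinfun_eqI) (simp add: scaleC_op.rep_eq blinfun.scaleR_left scaleR_scaleC)

lemma cstar_subalgebraD:
  assumes "cstar_subalgebra B"
  shows cstar_bounded_ops: "a \<in> B \<Longrightarrow> a \<in> bounded_ops"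
    and cstar_zero: "0 \<in> B"
    and cstar_add: "a \<in> B \<Longrightarrow> b \<in> B \<Longrightarrow> a + b \<in> B"
    and cstar_scaleR: "a \<in> B \<Longrightarrow> r *\<^sub>R a \<in> B"
    and cstar_compose: "a \<in> B \<Longrightarrow> b \<in> B \<Longrightarrow> a o\<^sub>L b \<in> B"
    and cstar_adj: "a \<in> B \<Longrightarrow> adj a \<in> B"
  using assms by (auto simp: cstar_subalgebra_def simp flip: scaleC_op_of_real)

lemma cstar_diff: "cstar_subalgebra B \<Longrightarrow> a \<in> B \<Longrightarrow> b \<in> B \<Longrightarrow> a - b \<in> B"
  using cstar_add[of B a "(-1) *\<^sub>R b"] cstar_scaleR[of B b "-1"] by simp

section \<open>Approximate inverses of a positive operator\<close>

text \<open>The partial sums of the Neumann series of \<open>D\<^sup>-\<^sup>1 = s\<^sup>-\<^sup>1 (1 - (1 - D/s))\<^sup>-\<^sup>1\<close>.\<close>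

primrec approx_inverse :: "real \<Rightarrow> ('h::complex_hilbert_space \<Rightarrow>\<^sub>L 'h) \<Rightarrow> nat \<Rightarrow> ('h \<Rightarrow>\<^sub>L 'h)" where
  "approx_inverse s D 0 = 0"
| "approx_inverse s D (Suc n) =
     (1/s) *\<^sub>R id_blinfun + ((id_blinfun - (1/s) *\<^sub>R D) o\<^sub>L approx_inverse s D n)"

lemma approx_inverse_commute:
  assumes "C o\<^sub>L D = D o\<^sub>L C"
  shows "C o\<^sub>L approx_inverse s D n = approx_inverse s D n o\<^sub>L C"
proof (induction n)
  case (Suc n)
  have "C o\<^sub>L (D o\<^sub>L approx_inverse s D n) = D o\<^sub>L (approx_inverse s D n o\<^sub>L C)"
    by (metis Suc assms compose_assoc)
  with Suc show ?case by (simp add: compose_simps compose_assoc)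
qed simp

lemma approx_inverse_in:
  assumes "cstar_subalgebra B" "id_blinfun \<in> B" "D \<in> B"
  shows "approx_inverse s D n \<in> B"
  by (induction n) (use assms in \<open>auto intro!: cstar_zero cstar_add cstar_diff cstar_compose cstar_scaleR\<close>)

lemma approx_inverse_selfadjoint:
  assumes D: "positive_op D"
  shows "approx_inverse s D n \<in> bounded_ops \<and> adj (approx_inverse s D n) = approx_inverse s D n"
  using D approx_inverse_commute[of D D s]
  by (induction n) (auto simp: adj_simps compose_simps)

text \<open>Starting from the identity at 0, the residual is thus the power E^n of E = 1 -
  D/s.\<close>

lemma approx_inverse_residual:
  "id_blinfun - (D o\<^sub>L approx_inverse s D (Suc n)) =
    (id_blinfun - (1/s) *\<^sub>R D) o\<^sub>L (id_blinfun - (D o\<^sub>L approx_inverse s D n))"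
  by (simp add: compose_simps compose_assoc algebra_simps)

text \<open>Since \<open>\<parallel>E z\<parallel>\<^sup>2 \<le> \<parallel>z\<parallel>\<^sup>2 - \<parallel>D z\<parallel>\<^sup>2 / s\<^sup>2\<close> for \<open>E = 1 - D/s\<close>, the squares \<open>\<parallel>D E\<^sup>k x\<parallel>\<^sup>2\<close>, which decrease
  in \<open>k\<close>, have sum at most \<open>s\<^sup>2 \<parallel>x\<parallel>\<^sup>2\<close>. Hence \<open>\<parallel>D E\<^sup>n\<parallel> \<le> s / \<surd>n\<close>.\<close>

lemma approx_inverse_residual_bound:
  fixes D :: "'h::complex_hilbert_space \<Rightarrow>\<^sub>L 'h"
  assumes D: "positive_op D" and s: "norm D \<le> s" "0 < s"
  defines "r \<equiv> \<lambda>n. id_blinfun - (D o\<^sub>L approx_inverse s D n)"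
  shows "real n * (norm (D (r n x)))\<^sup>2 + s\<^sup>2 * (norm (r n x))\<^sup>2 \<le> s\<^sup>2 * (norm x)\<^sup>2"
proof (induction n)
  case (Suc n)
  define E where "E = id_blinfun - (1/s) *\<^sub>R D"
  have E: "s\<^sup>2 * (norm (E z))\<^sup>2 \<le> s\<^sup>2 * (norm z)\<^sup>2 - (norm (D z))\<^sup>2" for z
  proof -
    have "Re (cinner y (D y)) \<le> s * (norm y)\<^sup>2" for y
      using Re_cinner_op_le[of y D] mult_right_mono[OF s(1), of "(norm y)\<^sup>2"] by simp
    then have le: "(norm (D z))\<^sup>2 \<le> s * Re (cinner z (D z))" by (rule positive_op_norm_bound[OF D])
    have "Re (cinner (D z) z) = Re (cinner z (D z))" by (rule Re_cinner_commute)
    then have "s\<^sup>2 * (norm (E z))\<^sup>2 = s\<^sup>2 * (norm z)\<^sup>2 - 2 * s * Re (cinner z (D z)) + (norm (D z))\<^sup>2"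
      using s(2) by (simp add: E_def blinfun.diff_left blinfun.scaleR_left cinner_simps
          field_simps power2_eq_square flip: Re_cinner_self[unfolded power2_eq_square])
    also have "\<dots> \<le> s\<^sup>2 * (norm z)\<^sup>2 - (norm (D z))\<^sup>2" using le by simp
    finally show ?thesis .
  qed
  have "E o\<^sub>L D = D o\<^sub>L E" by (simp add: E_def compose_simps)
  moreover have r: "r (Suc n) = E o\<^sub>L r n" unfolding r_def E_def by (rule approx_inverse_residual)
  ultimately have Dr: "D (r (Suc n) x) = E (D (r n x))" by (metis blinfun_apply_blinfun_compose)
  have "(norm (D (r (Suc n) x)))\<^sup>2 \<le> (norm (D (r n x)))\<^sup>2"
  proof (rule mult_left_le_imp_le)
    show "s\<^sup>2 * (norm (D (r (Suc n) x)))\<^sup>2 \<le> s\<^sup>2 * (norm (D (r n x)))\<^sup>2"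
      unfolding Dr using E[of "D (r n x)"] by (rule order_trans) simp
  qed (use s in simp)
  \<comment> \<open>Of the \<open>Suc n\<close> copies of the old term, \<open>n\<close> are covered
    by the induction hypothesis and one by the drop of the squared norm of the residual.\<close>
  then have "real (Suc n) * (norm (D (r (Suc n) x)))\<^sup>2 \<le> real (Suc n) * (norm (D (r n x)))\<^sup>2"
    by (intro mult_left_mono) simp_all
  moreover have "s\<^sup>2 * (norm (r (Suc n) x))\<^sup>2 \<le> s\<^sup>2 * (norm (r n x))\<^sup>2 - (norm (D (r n x)))\<^sup>2"
    using E[of "r n x"] by (simp add: r)
  ultimately have "real (Suc n) * (norm (D (r (Suc n) x)))\<^sup>2 + s\<^sup>2 * (norm (r (Suc n) x))\<^sup>2
      \<le> real (Suc n) * (norm (D (r n x)))\<^sup>2 + (s\<^sup>2 * (norm (r n x))\<^sup>2 - (norm (D (r n x)))\<^sup>2)"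
    by (rule add_mono)
  also have "\<dots> = real n * (norm (D (r n x)))\<^sup>2 + s\<^sup>2 * (norm (r n x))\<^sup>2"
    by (simp add: algebra_simps)
  finally show ?case using Suc by (rule order_trans)
qed (simp add: r_def)

text \<open>\<open>D\<close> may fail to be invertible, so \<open>q\<close> itself may be unbounded.
  One factor \<open>D\<close> makes it bounded, and a second one gives norm convergence.\<close>

lemma approx_inverse_exists:
  assumes D: "positive_op D" and B: "cstar_subalgebra B" "id_blinfun \<in> B" "D \<in> B"
  obtains q where "\<And>n. q n \<in> B" "\<And>n. adj (q n) = q n"
    "\<And>n C. C o\<^sub>L D = D o\<^sub>L C \<Longrightarrow> C o\<^sub>L q n = q n o\<^sub>L C"
    "\<And>n. norm (D o\<^sub>L q n) \<le> 2"
    "(\<lambda>n. D o\<^sub>L (D o\<^sub>L q n)) \<longlonglongrightarrow> D"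
proof
  \<comment> \<open>The summand 1 keeps \<open>s\<close> positive when \<open>D = 0\<close>.\<close>
  define s where "s = norm D + 1"
  have s: "norm D \<le> s" "0 < s" by (simp_all add: s_def add_nonneg_pos)
  define q where "q = approx_inverse s D"
  note bound = approx_inverse_residual_bound[OF D s, folded q_def]
  show "q n \<in> B" for n unfolding q_def by (rule approx_inverse_in[OF B])
  show "adj (q n) = q n" for n unfolding q_def using approx_inverse_selfadjoint[OF D] by blast
  show "C o\<^sub>L q n = q n o\<^sub>L C" if "C o\<^sub>L D = D o\<^sub>L C" for n C
    unfolding q_def by (rule approx_inverse_commute[OF that])
  show "norm (D o\<^sub>L q n) \<le> 2" for n
  proof -
    have "norm (id_blinfun - (D o\<^sub>L q n)) \<le> 1"
    proof (rule norm_blinfun_bound)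
      fix x
      have "0 \<le> real n * (norm (D ((id_blinfun - (D o\<^sub>L q n)) x)))\<^sup>2" by simp
      then have "s\<^sup>2 * (norm ((id_blinfun - (D o\<^sub>L q n)) x))\<^sup>2 \<le> s\<^sup>2 * (norm x)\<^sup>2"
        using bound[of n x] by linarith
      then have "(norm ((id_blinfun - (D o\<^sub>L q n)) x))\<^sup>2 \<le> (norm x)\<^sup>2"
        using s(2) by (simp del: power_mono_iff)
      then show "norm ((id_blinfun - (D o\<^sub>L q n)) x) \<le> 1 * norm x"
        using power2_le_imp_le by fastforce
    qed simp
    moreover have "norm (id_blinfun :: 'a \<Rightarrow>\<^sub>L 'a) \<le> 1" by (rule norm_blinfun_bound) simp_all
    ultimately show ?thesis using norm_triangle_sub[of "D o\<^sub>L q n" id_blinfun] 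
      by (simp add: norm_minus_commute)
  qed
  \<comment> \<open>The operator is \<open>D\<close> applied to the residual. At
    \<open>n = 0\<close> the right-hand side would be 0 by the convention for division, hence the
    restriction.\<close>
  have le: "norm (D - (D o\<^sub>L (D o\<^sub>L q n))) \<le> s / sqrt (real n)" if "n > 0" for n
  proof (rule norm_blinfun_bound)
    fix x
    have "0 \<le> s\<^sup>2 * (norm ((id_blinfun - (D o\<^sub>L q n)) x))\<^sup>2" by simp
    then have "real n * (norm (D ((id_blinfun - (D o\<^sub>L q n)) x)))\<^sup>2 \<le> s\<^sup>2 * (norm x)\<^sup>2"
      using bound[of n x] by linarith
    then have "(norm (D ((id_blinfun - (D o\<^sub>L q n)) x)))\<^sup>2 \<le> (s / sqrt (real n) * norm x)\<^sup>2"
      using that by (simp add: power_mult_distrib power_divide field_simps)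
    then have "norm (D ((id_blinfun - (D o\<^sub>L q n)) x)) \<le> s / sqrt (real n) * norm x"
      by (rule power2_le_imp_le) (use s in simp)
    then show "norm ((D - (D o\<^sub>L (D o\<^sub>L q n))) x) \<le> s / sqrt (real n) * norm x"
      by (simp add: blinfun.diff_left blinfun.diff_right)
  qed (use s in simp)
  have "(\<lambda>n. D - (D o\<^sub>L (D o\<^sub>L q n))) \<longlonglongrightarrow> 0"
  proof (rule Lim_null_comparison)
    show "\<forall>\<^sub>F n in sequentially. norm (D - (D o\<^sub>L (D o\<^sub>L q n))) \<le> s / sqrt (real n)"
      using eventually_gt_at_top[of 0] by eventually_elim (rule le)
    show "(\<lambda>n. s / sqrt (real n)) \<longlonglongrightarrow> 0"
      by (intro tendsto_divide_0[OF tendsto_const] filterlim_at_top_imp_at_infinity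
          filterlim_compose[OF sqrt_at_top filterlim_real_sequentially])
  qed
  from tendsto_diff[OF tendsto_const[of D] this]
  show "(\<lambda>n. D o\<^sub>L (D o\<^sub>L q n)) \<longlonglongrightarrow> D" by simp
qed

section \<open>Inner product modules\<close>

context inner_product_module
begin

lemma ip_bounded_ops [simp]: "ip x y \<in> bounded_ops"
  using cstar_bounded_ops[OF cstar ip_in] .

lemma adj_ip: "adj (ip x y) = ip y x"
  by (rule ip_commute[symmetric])

lemma ip_add_left: "ip (x + y) z = ip x z + ip y z"
  by (subst ip_commute) (simp add: ip_add_right adj_add adj_ip)

lemma ip_diff_right: "ip x (y - z) = ip x y - ip x z"
  using ip_add_right[of x "y - z" z] by simp

lemma ip_diff_left: "ip (x - y) z = ip x z - ip y z"
  using ip_add_left[of "x - y" y z] by simp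

lemma ip_zero_right [simp]: "ip x 0 = 0"
  using ip_diff_right[of x 0 0] by simp

lemma ip_zero_left [simp]: "ip 0 x = 0"
  using ip_diff_left[of 0 0 x] by simp

lemma ip_act_left: "a \<in> A \<Longrightarrow> ip (act x a) y = adj a o\<^sub>L ip x y"
  by (subst ip_commute) (simp add: ip_act_right adj_compose adj_ip cstar_bounded_ops[OF cstar])

lemma ip_of_real_right: "ip x (of_real r *\<^sub>C y) = r *\<^sub>R ip x y"
  by (simp add: ip_scaleC_right scaleC_op_of_real)

lemma ip_of_real_left: "ip (of_real r *\<^sub>C x) y = r *\<^sub>R ip x y"
  by (subst ip_commute) (simp add: ip_of_real_right adj_scaleR adj_ip)

text \<open>With D = <x,x>, the relation D^2 a = 0 gives (D a)' (D a) = 0 for the adjoint (D a)', so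
  D a = 0 and <xa,xa> = a' D a = 0. In this way a possibly singular D is cancelled through the
  module.\<close>

lemma act_eq_zeroI:
  assumes a: "a \<in> A" and "ip x x o\<^sub>L (ip x x o\<^sub>L a) = 0"
  shows "act x a = 0"
proof -
  have [simp]: "a \<in> bounded_ops" using a cstar_bounded_ops[OF cstar] by blast
  have "adj (ip x x o\<^sub>L a) o\<^sub>L (ip x x o\<^sub>L a) = 0"
    using assms(2) by (simp add: adj_compose adj_ip compose_assoc)
  then have "ip x x o\<^sub>L a = 0" using adj_compose_self_eq_zero[of "ip x x o\<^sub>L a"] by simp
  then have "ip (act x a) (act x a) = 0" using a by (simp add: ip_act_left ip_act_right compose_assoc)
  then show ?thesis by (simp add: ip_eq_zero_iff)
qed

text \<open>Cancel on the side of \<open>x\<close>, pair the result with \<open>y\<close>, cancel on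
  the side of \<open>y\<close>, and pair with \<open>x\<close>. For X = <x,y> this leaves X X' X =
  0, so the self-adjoint X' X has square zero.\<close>

lemma ip_cancel:
  assumes eq: "ip x x o\<^sub>L (ip x x o\<^sub>L (ip x y o\<^sub>L (ip y y o\<^sub>L ip y y))) = 0"
  shows "ip x y = 0"
proof -
  let ?X = "ip x y" and ?E = "ip y y o\<^sub>L ip y y"
  note in_A = ip_in cstar_compose[OF cstar]
  have "act x (?X o\<^sub>L ?E) = 0" using eq by (intro act_eq_zeroI in_A) simp_all
  then have "0 = ip (act x (?X o\<^sub>L ?E)) y" by simp
  also have "\<dots> = ip y y o\<^sub>L (ip y y o\<^sub>L (adj ?X o\<^sub>L ?X))"
    by (simp add: ip_act_left in_A adj_compose adj_ip compose_assoc)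
  finally have "act y (adj ?X o\<^sub>L ?X) = 0"
    by (intro act_eq_zeroI) (simp_all add: in_A adj_ip)
  then have "0 = ip x (act y (adj ?X o\<^sub>L ?X))" by simp
  also have "\<dots> = ?X o\<^sub>L (adj ?X o\<^sub>L ?X)" by (simp add: ip_act_right in_A adj_ip)
  finally have "adj (adj ?X o\<^sub>L ?X) o\<^sub>L (adj ?X o\<^sub>L ?X) = 0"
    by (simp add: adj_compose compose_assoc)
  then have "adj ?X o\<^sub>L ?X = 0" using adj_compose_self_eq_zero[of "adj ?X o\<^sub>L ?X"] by simp
  then show ?thesis using adj_compose_self_eq_zero[of ?X] by simp
qed

text \<open>Commutativity lets the phases \<open>T\<close> and \<open>T'\<close> meet their adjoints
  when \<open>rel\<close> is squared. The remaining factors \<open>ip z z\<close> and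
  \<open>ip z' z'\<close> are cancelled through the module.\<close>

lemma abelian_phase_invariance:
  assumes ab: "abelian A"
    and v: "ip v v = ip z z" "ip v' v' = ip z' z'"
    and T: "T \<in> A" "T o\<^sub>L adj T = ip z z o\<^sub>L ip z z"
    and T': "T' \<in> A" "T' o\<^sub>L adj T' = ip z' z' o\<^sub>L ip z' z'"
    and rel: "ip z z o\<^sub>L (ip v v' o\<^sub>L ip z' z') = adj T o\<^sub>L (ip z z' o\<^sub>L T')"
  shows "adj (ip v v') o\<^sub>L ip v v' = adj (ip z z') o\<^sub>L ip z z'"
proof -
  define D where "D = ip z z"
  define D' where "D' = ip z' z'"
  define W where "W = ip v v'"
  define S where "S = ip z z'"
  define K where "K = (adj W o\<^sub>L W) - (adj S o\<^sub>L S)"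
  note cs = cstar_adj[OF cstar] cstar_compose[OF cstar] cstar_diff[OF cstar]
  have in_A: "D \<in> A" "D' \<in> A" "W \<in> A" "S \<in> A" "adj W \<in> A" "adj S \<in> A" "adj T \<in> A" "adj T' \<in> A"
    "T \<in> A" "T' \<in> A"
    using T(1) T'(1) by (simp_all add: D_def D'_def W_def S_def ip_in cs)
  then have K: "K \<in> A" by (simp add: K_def cs)
  note in_A = in_A K
  have [simp]: "W \<in> bounded_ops" "S \<in> bounded_ops" "D \<in> bounded_ops" "D' \<in> bounded_ops"
    "T \<in> bounded_ops" "T' \<in> bounded_ops" "K \<in> bounded_ops"
    using in_A cstar_bounded_ops[OF cstar] by blast+
  have comm: "a o\<^sub>L b = b o\<^sub>L a" if "a \<in> A" "b \<in> A" for a b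
    using ab that by (simp add: abelian_def)
  have left_comm: "a o\<^sub>L (b o\<^sub>L e) = b o\<^sub>L (a o\<^sub>L e)" if "a \<in> A" "b \<in> A" for a b e
    using comm[OF that] by (metis compose_assoc)
  note ac = compose_assoc comm left_comm in_A
  have sa: "adj D = D" "adj D' = D'" by (simp_all add: D_def D'_def adj_ip)
  define X where "X = D o\<^sub>L (W o\<^sub>L D')"
  have X: "X = adj T o\<^sub>L (S o\<^sub>L T')" using rel by (simp add: X_def D_def D'_def W_def S_def)
  \<comment> \<open>Compute \<open>adj X o\<^sub>L X\<close> from both expressions for
    \<open>X\<close>.\<close>
  have "D o\<^sub>L (D o\<^sub>L (D' o\<^sub>L (D' o\<^sub>L (adj W o\<^sub>L W)))) = adj X o\<^sub>L X"
    by (simp add: X_def adj_compose sa ac)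
  also have "\<dots> = (T o\<^sub>L adj T) o\<^sub>L ((T' o\<^sub>L adj T') o\<^sub>L (adj S o\<^sub>L S))"
    by (simp add: X adj_compose ac)
  also have "\<dots> = D o\<^sub>L (D o\<^sub>L (D' o\<^sub>L (D' o\<^sub>L (adj S o\<^sub>L S))))"
    by (simp add: T(2) T'(2) D_def D'_def compose_assoc)
  finally have zero: "D o\<^sub>L (D o\<^sub>L (D' o\<^sub>L (D' o\<^sub>L K))) = 0"
    by (simp add: K_def compose_diff_right)
  \<comment> \<open>Stated for any pair with diagonal products \<open>D\<close> and
    \<open>D'\<close>, since it is applied to \<open>v, v'\<close> and to \<open>z, z'\<close>. The
    difference of the two instances is K^2 = 0.\<close>
  have annihilate: "ip y y' o\<^sub>L (adj (ip y y') o\<^sub>L K) = 0" if y: "ip y y = D" "ip y' y' = D'" for y y'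
  proof -
    let ?Y = "ip y y'"
    have Y: "?Y \<in> A" "adj ?Y \<in> A" by (simp_all add: ip_in cs)
    have "act y (D' o\<^sub>L (D' o\<^sub>L K)) = 0" using zero by (intro act_eq_zeroI) (simp_all add: y in_A cs)
    then have "0 = ip y' (act y (D' o\<^sub>L (D' o\<^sub>L K)))" by simp
    also have "\<dots> = adj ?Y o\<^sub>L (D' o\<^sub>L (D' o\<^sub>L K))" by (simp add: ip_act_right in_A cs adj_ip)
    also have "\<dots> = D' o\<^sub>L (D' o\<^sub>L (adj ?Y o\<^sub>L K))" using Y by (metis left_comm in_A(2))
    finally have "act y' (adj ?Y o\<^sub>L K) = 0"
      by (intro act_eq_zeroI) (use Y in \<open>simp_all add: y in_A cs\<close>)
    then have "0 = ip y (act y' (adj ?Y o\<^sub>L K))" by simp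
    also have "\<dots> = ?Y o\<^sub>L (adj ?Y o\<^sub>L K)" using Y by (simp add: ip_act_right in_A cs)
    finally show ?thesis by simp
  qed
  have "W o\<^sub>L (adj W o\<^sub>L K) = 0" "S o\<^sub>L (adj S o\<^sub>L K) = 0"
    unfolding W_def S_def by (intro annihilate; simp add: D_def D'_def v)+
  then have "adj W o\<^sub>L (W o\<^sub>L K) = 0" "adj S o\<^sub>L (S o\<^sub>L K) = 0" by (metis left_comm in_A(3-6))+
  then have "((adj W o\<^sub>L W) - (adj S o\<^sub>L S)) o\<^sub>L K = 0"
    by (simp add: compose_diff_left compose_assoc)
  moreover have "adj K = K" by (simp add: K_def adj_diff adj_compose)
  ultimately have "adj K o\<^sub>L K = 0" by (simp flip: K_def)
  then have "K = 0" using adj_compose_self_eq_zero[of K] by simp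
  then show ?thesis by (simp add: K_def W_def S_def)
qed

text \<open>Applied with \<open>z = J x\<close> and \<open>w = f x\<close>. The identity must lie in
  \<open>A\<close> so that the approximate inverses do, and hence may act on
  \<open>z\<close>.\<close>

lemma phase_correction:
  assumes unit: "id_blinfun \<in> A"
    and compact: "\<And>v :: nat \<Rightarrow> 'm. (\<exists>K. \<forall>n. module_norm ip (v n) \<le> K) \<Longrightarrow>
           \<exists>l v0. strict_mono (l :: nat \<Rightarrow> nat) \<and>
             (\<forall>w. (\<lambda>n. norm (ip (v (l n)) w - ip v0 w)) \<longlonglongrightarrow> 0)"
    and TT: "adj (ip z w) o\<^sub>L ip z w = ip z z o\<^sub>L ip z z"
      "ip z w o\<^sub>L adj (ip z w) = ip z z o\<^sub>L ip z z"
  shows "\<exists>v. ip v w = ip z z \<and> ip v v = ip z z \<and> act v (ip z z) = act z (ip z w)"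
proof -
  define T where "T = ip z w"
  define D where "D = ip z z"
  have TT: "adj T o\<^sub>L T = D o\<^sub>L D" "T o\<^sub>L adj T = D o\<^sub>L D" using TT by (simp_all add: T_def D_def)
  have D_pos: "positive_op D" unfolding D_def by (rule ip_positive)
  have in_A: "T \<in> A" "D \<in> A" by (simp_all add: T_def D_def ip_in)
  note cs = cstar_adj[OF cstar] cstar_compose[OF cstar]
  have [simp]: "T \<in> bounded_ops" "D \<in> bounded_ops" "adj D = D"
    by (simp_all add: T_def D_def adj_ip)
  \<comment> \<open>By \<open>TT\<close>, both T D^2 and D^2 T equal T T' T with T' the adjoint, so
    \<open>T\<close> commutes with D^2 and thus with its positive root.\<close>
  have TD: "T o\<^sub>L D = D o\<^sub>L T"
    by (rule positive_sqrt_commute[OF D_pos]) (metis TT compose_assoc)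
  have "adj (T o\<^sub>L D) = adj (D o\<^sub>L T)" by (simp only: TD)
  then have T'D: "adj T o\<^sub>L D = D o\<^sub>L adj T" by (simp add: adj_compose)
  obtain q where q: "\<And>n. q n \<in> A" "\<And>n. adj (q n) = q n"
    and q_comm: "\<And>n C. C o\<^sub>L D = D o\<^sub>L C \<Longrightarrow> C o\<^sub>L q n = q n o\<^sub>L C"
    and q_bound: "\<And>n. norm (D o\<^sub>L q n) \<le> 2"
    and q_lim: "(\<lambda>n. D o\<^sub>L (D o\<^sub>L q n)) \<longlonglongrightarrow> D"
    using approx_inverse_exists[OF D_pos cstar unit in_A(2)] by blast
  have qD: "q n o\<^sub>L D = D o\<^sub>L q n" for n using q_comm[of D n] by simp
  have [simp]: "q n \<in> bounded_ops" for n using q(1) cstar_bounded_ops[OF cstar] by blast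
  define v where "v n = act z (T o\<^sub>L q n)" for n
  have vu: "ip (v n) u = q n o\<^sub>L (adj T o\<^sub>L ip z u)" for n u
    using q in_A by (simp add: v_def ip_act_left cs adj_compose compose_assoc)
  \<comment> \<open>Grouped so that each factor is bounded and the right one converges in
    \<open>m\<close>.\<close>
  have vv: "ip (v n) (v m) = (D o\<^sub>L q n) o\<^sub>L (D o\<^sub>L (D o\<^sub>L q m))" for n m
  proof -
    have "ip (v n) (v m) = q n o\<^sub>L (adj T o\<^sub>L (D o\<^sub>L (T o\<^sub>L q m)))"
      unfolding vu unfolding v_def using q in_A by (simp add: ip_act_right cs flip: D_def)
    also have "\<dots> = q n o\<^sub>L (D o\<^sub>L ((adj T o\<^sub>L T) o\<^sub>L q m))"
      by (metis T'D compose_assoc)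
    also have "\<dots> = (D o\<^sub>L q n) o\<^sub>L (D o\<^sub>L (D o\<^sub>L q m))"
      unfolding TT by (metis qD compose_assoc)
    finally show ?thesis .
  qed
  have "module_norm ip (v n) \<le> sqrt (2 * (norm D * 2))" for n
    unfolding module_norm_def vv
    by (intro real_sqrt_le_mono order_trans[OF norm_blinfun_compose] mult_mono q_bound) auto
  then obtain l v0 where l: "strict_mono l"
    and "\<And>w. (\<lambda>n. norm (ip (v (l n)) w - ip v0 w)) \<longlonglongrightarrow> 0"
    using compact[of v] by blast
  then have lim: "(\<lambda>n. ip (v (l n)) u) \<longlonglongrightarrow> ip v0 u" for u
    by (metis LIM_zero_cancel tendsto_norm_zero_cancel)
  have lim': "(\<lambda>n. ip u (v (l n))) \<longlonglongrightarrow> ip u v0" for u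
    using tendsto_adj[OF lim] by (simp add: adj_ip)
  have q_lim: "(\<lambda>n. D o\<^sub>L (D o\<^sub>L q (l n))) \<longlonglongrightarrow> D"
    using LIMSEQ_subseq_LIMSEQ[OF q_lim l] by (simp add: o_def)
  \<comment> \<open>Iterated limit: the second argument goes to \<open>v0\<close> first with
    \<open>n\<close> fixed, then the first one in \<open>v0v0\<close>.\<close>
  have vv0: "ip (v n) v0 = D o\<^sub>L (D o\<^sub>L q n)" for n
  proof (rule LIMSEQ_unique)
    show "(\<lambda>m. ip (v n) (v (l m))) \<longlonglongrightarrow> (D o\<^sub>L (D o\<^sub>L q n))"
    proof -
      have "(\<lambda>m. (D o\<^sub>L q n) o\<^sub>L (D o\<^sub>L (D o\<^sub>L q (l m)))) \<longlonglongrightarrow> ((D o\<^sub>L q n) o\<^sub>L D)"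
        by (intro tendsto_compose_op tendsto_const q_lim)
      then show ?thesis by (simp add: vv compose_assoc qD)
    qed
  qed (rule lim')
  have v0v0: "ip v0 v0 = D"
    using LIMSEQ_unique[OF lim[of v0]] q_lim by (simp add: vv0)
  have "ip (v n) w = D o\<^sub>L (D o\<^sub>L q n)" for n
    unfolding vu T_def[symmetric] TT by (metis qD compose_assoc)
  then have v0w: "ip v0 w = D" using LIMSEQ_unique[OF lim[of w]] q_lim by simp
  have v0z: "ip v0 z o\<^sub>L T = D o\<^sub>L D"
  proof (rule LIMSEQ_unique)
    show "(\<lambda>n. ip (v (l n)) z o\<^sub>L T) \<longlonglongrightarrow> (ip v0 z o\<^sub>L T)"
      by (intro tendsto_compose_op tendsto_const lim)
    have "ip (v n) z o\<^sub>L T = D o\<^sub>L (D o\<^sub>L (D o\<^sub>L q n))" for n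
    proof -
      have "ip (v n) z o\<^sub>L T = q n o\<^sub>L (D o\<^sub>L (adj T o\<^sub>L T))"
        unfolding vu D_def[symmetric] by (metis T'D compose_assoc)
      also have "\<dots> = D o\<^sub>L (D o\<^sub>L (D o\<^sub>L q n))" unfolding TT by (metis qD compose_assoc)
      finally show ?thesis .
    qed
    then show "(\<lambda>n. ip (v (l n)) z o\<^sub>L T) \<longlonglongrightarrow> (D o\<^sub>L D)"
      by (simp, intro tendsto_compose_op tendsto_const q_lim)
  qed
  \<comment> \<open>All four products of the two vectors equal D^3, so their difference has product
    zero with itself.\<close>
  have "act v0 D = act z T"
  proof -
    let ?x = "act z T" and ?y = "act v0 D" and ?d = "D o\<^sub>L (D o\<^sub>L D)"
    have xx: "ip ?x ?x = ?d"
    proof -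
      have "ip ?x ?x = adj T o\<^sub>L (D o\<^sub>L T)"
        using in_A by (simp add: ip_act_left ip_act_right compose_assoc flip: D_def)
      also have "\<dots> = ?d" by (metis T'D TT(1) compose_assoc)
      finally show ?thesis .
    qed
    have yy: "ip ?y ?y = ?d" using in_A by (simp add: ip_act_left ip_act_right v0v0 compose_assoc)
    have yx: "ip ?y ?x = ?d" using in_A by (simp add: ip_act_left ip_act_right v0z compose_assoc)
    have "ip ?x ?y = adj (ip ?y ?x)" by (simp add: adj_ip)
    also have "\<dots> = ?d" unfolding yx by (simp add: adj_compose compose_assoc)
    finally have "ip (?y - ?x) (?y - ?x) = 0" using xx yy yx by (simp add: ip_diff_left ip_diff_right)
    then show ?thesis by (simp add: ip_eq_zero_iff)
  qed
  with v0v0 v0w show ?thesis unfolding D_def T_def by blast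
qed

end

section \<open>Perturbed Wigner equation\<close>

theorem theorem2p2:
  fixes A B :: "('h::complex_hilbert_space \<Rightarrow>\<^sub>L 'h) set"
    and actM :: "'m::complex_vector \<Rightarrow> ('h \<Rightarrow>\<^sub>L 'h) \<Rightarrow> 'm"
    and ipM :: "'m \<Rightarrow> 'm \<Rightarrow> ('h \<Rightarrow>\<^sub>L 'h)"
    and actN :: "'n::complex_vector \<Rightarrow> ('h \<Rightarrow>\<^sub>L 'h) \<Rightarrow> 'n"
    and ipN :: "'n \<Rightarrow> 'n \<Rightarrow> ('h \<Rightarrow>\<^sub>L 'h)"
    and \<phi> :: "'m \<Rightarrow> 'm \<Rightarrow> real"
    and c :: real
    and f :: "'m \<Rightarrow> 'n"
  assumes "cstar_subalgebra A"
    and "von_neumann_algebra B"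
    and "inner_product_module A actM ipM"
    and "inner_product_module B actN ipN"
    and "\<And>v :: nat \<Rightarrow> 'n. (\<exists>K. \<forall>n. module_norm ipN (v n) \<le> K) \<Longrightarrow>
           \<exists>l v0. strict_mono (l :: nat \<Rightarrow> nat) \<and>
             (\<forall>w. (\<lambda>n. norm (ipN (v (l n)) w - ipN v0 w)) \<longlonglongrightarrow> 0)"
    and "\<And>x y. 0 \<le> \<phi> x y"
    and "c > 0" and "c \<noteq> 1"
    and "\<And>x y. (\<lambda>n. c ^ n * \<phi> (complex_of_real (inverse (c ^ n)) *\<^sub>C x) y) \<longlonglongrightarrow> 0"
    and "\<And>x y. (\<lambda>n. c ^ n * \<phi> x (complex_of_real (inverse (c ^ n)) *\<^sub>C y)) \<longlonglongrightarrow> 0"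
    and "\<And>x. Bseq (\<lambda>n. c ^ (2 * n) *
           \<phi> (complex_of_real (inverse (c ^ n)) *\<^sub>C x) (complex_of_real (inverse (c ^ n)) *\<^sub>C x))"
    and "\<And>x y. norm (abs_op (ipN (f x) (f y)) - abs_op (ipM x y)) \<le> \<phi> x y"
  shows "\<exists>I :: 'm \<Rightarrow> 'n.
           (\<forall>x. ipN (I x) (I x) = ipM x x) \<and>
           (\<forall>x y. ipM x y = 0 \<longleftrightarrow> ipN (I x) (I y) = 0) \<and>
           (\<forall>x. module_norm ipN (f x - I x) \<le> sqrt (\<phi> x x)) \<and>
           (\<exists>h :: 'm \<Rightarrow> 'n. \<forall>x. f x = h x + I x \<and> ipN (h x) (I x) = 0 \<and>
              module_norm ipN (h x) \<le> sqrt (\<phi> x x)) \<and>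
           (abelian B \<longrightarrow> (\<forall>x y. abs_op (ipN (I x) (I y)) = abs_op (ipM x y)))"
proof -
  interpret M: inner_product_module A actM ipM by fact
  interpret N: inner_product_module B actN ipN by fact
  note compact = assms(5) and c = \<open>c > 0\<close>
    and phi_left = assms(9) and phi_right = assms(10) and phi_diag = assms(11) and near = assms(12)
  have unit: "id_blinfun \<in> B" using assms(2) by (simp add: von_neumann_algebra_def)

  \<comment> \<open>Rescaled maps and their weak cluster points\<close>
  define \<sigma> where "\<sigma> n x = complex_of_real (inverse (c ^ n)) *\<^sub>C x" for n and x :: 'm
  define F where "F n x = complex_of_real (c ^ n) *\<^sub>C f (\<sigma> n x)" for n x
  have abs_scale_left: "c ^ n *\<^sub>R abs_op (ipM (\<sigma> n x) y) = abs_op (ipM x y)" for n x y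
    using c by (simp only: \<sigma>_def M.ip_of_real_left) (simp add: abs_op_scaleR)
  have abs_scale_right: "c ^ n *\<^sub>R abs_op (ipM x (\<sigma> n y)) = abs_op (ipM x y)" for n x y
    using c by (simp only: \<sigma>_def M.ip_of_real_right) (simp add: abs_op_scaleR)
  have F_left: "norm (abs_op (ipN (F n x) (f y)) - abs_op (ipM x y)) \<le> c ^ n * \<phi> (\<sigma> n x) y" for n x y
  proof -
    have "abs_op (ipN (F n x) (f y)) - abs_op (ipM x y)
        = c ^ n *\<^sub>R (abs_op (ipN (f (\<sigma> n x)) (f y)) - abs_op (ipM (\<sigma> n x) y))"
      unfolding abs_scale_left[of n x y, symmetric] F_def N.ip_of_real_left
      using c by (simp add: abs_op_scaleR scaleR_diff_right)
    then show ?thesis using near[of "\<sigma> n x" y] c by simp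
  qed
  have F_right: "norm (abs_op (ipN (f x) (F n y)) - abs_op (ipM x y)) \<le> c ^ n * \<phi> x (\<sigma> n y)" for n x y
  proof -
    have "abs_op (ipN (f x) (F n y)) - abs_op (ipM x y)
        = c ^ n *\<^sub>R (abs_op (ipN (f x) (f (\<sigma> n y))) - abs_op (ipM x (\<sigma> n y)))"
      unfolding abs_scale_right[of n x y, symmetric] F_def N.ip_of_real_right
      using c by (simp add: abs_op_scaleR scaleR_diff_right)
    then show ?thesis using near[of x "\<sigma> n y"] c by simp
  qed
  \<comment> \<open>On the diagonal the products are positive and equal their absolute values; the
    estimate at \<open>\<sigma> n x\<close> times \<open>c ^ (2 * n)\<close> is bounded by
    \<open>phi_diag\<close>.\<close>
  have "\<exists>K. \<forall>n. module_norm ipN (F n x) \<le> K" for x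
  proof -
    obtain K where K: "\<And>n. norm (c ^ (2 * n) * \<phi> (\<sigma> n x) (\<sigma> n x)) \<le> K"
      using phi_diag[of x] unfolding Bseq_def \<sigma>_def by blast
    have cc: "c ^ n * c ^ n * (inverse (c ^ n) * inverse (c ^ n)) = 1" for n
      using c by (simp add: field_simps)
    have "module_norm ipN (F n x) \<le> sqrt (K + norm (ipM x x))" for n
    proof -
      have "ipN (F n x) (F n x) - ipM x x
          = c ^ (2 * n) *\<^sub>R (ipN (f (\<sigma> n x)) (f (\<sigma> n x)) - ipM (\<sigma> n x) (\<sigma> n x))"
        unfolding F_def N.ip_of_real_left N.ip_of_real_right
        unfolding \<sigma>_def M.ip_of_real_left M.ip_of_real_right
        using c by (simp add: scaleR_diff_right mult_2 power_add cc)
      moreover have "norm (ipN (f (\<sigma> n x)) (f (\<sigma> n x)) - ipM (\<sigma> n x) (\<sigma> n x)) \<le> \<phi> (\<sigma> n x) (\<sigma> n x)"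
        using near[of "\<sigma> n x" "\<sigma> n x"] by (simp add: abs_op_positive N.ip_positive M.ip_positive)
      ultimately have "norm (ipN (F n x) (F n x) - ipM x x) \<le> c ^ (2 * n) * \<phi> (\<sigma> n x) (\<sigma> n x)"
        using c by (simp add: mult_left_mono)
      also have "\<dots> \<le> K" using K[of n] by simp
      finally show ?thesis
        using norm_triangle_sub[of "ipN (F n x) (F n x)" "ipM x x"] by (simp add: module_norm_def)
    qed
    then show ?thesis by blast
  qed
  then have "\<forall>x. \<exists>l v0. strict_mono (l :: nat \<Rightarrow> nat) \<and>
      (\<forall>w. (\<lambda>n. norm (ipN (F (l n) x) w - ipN v0 w)) \<longlonglongrightarrow> 0)"
    using compact[of "\<lambda>n. F n x" for x] by blast
  then obtain l J where l: "\<And>x. strict_mono (l x :: nat \<Rightarrow> nat)"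
    and J: "\<And>x w. (\<lambda>n. norm (ipN (F (l x n) x) w - ipN (J x) w)) \<longlonglongrightarrow> 0"
    by metis
  have lim_left: "(\<lambda>n. ipN (F (l x n) x) w) \<longlonglongrightarrow> ipN (J x) w" for x w
    using J[of x w] by (metis LIM_zero_cancel tendsto_norm_zero_cancel)
  have lim_right: "(\<lambda>n. ipN w (F (l x n) x)) \<longlonglongrightarrow> ipN w (J x)" for x w
    using tendsto_adj[OF lim_left[of x w]] by (simp add: N.adj_ip)
  have Jf: "abs_op (ipN (J x) (f y)) = abs_op (ipM x y)" for x y
  proof (rule abs_op_tendsto_unique[OF lim_left])
    have "(\<lambda>n. c ^ l x n * \<phi> (\<sigma> (l x n) x) y) \<longlonglongrightarrow> 0"
      using LIMSEQ_subseq_LIMSEQ[OF phi_left l[of x]] by (simp add: o_def \<sigma>_def)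
    then have "(\<lambda>n. abs_op (ipN (F (l x n) x) (f y)) - abs_op (ipM x y)) \<longlonglongrightarrow> 0"
      by (rule Lim_null_comparison[rotated]) (simp add: F_left)
    then show "(\<lambda>n. abs_op (ipN (F (l x n) x) (f y))) \<longlonglongrightarrow> abs_op (ipM x y)"
      by (rule LIM_zero_cancel)
  qed (simp_all add: positive_abs_op)
  have fJ: "abs_op (ipN (f x) (J y)) = abs_op (ipM x y)" for x y
  proof (rule abs_op_tendsto_unique[OF lim_right])
    have "(\<lambda>n. c ^ l y n * \<phi> x (\<sigma> (l y n) y)) \<longlonglongrightarrow> 0"
      using LIMSEQ_subseq_LIMSEQ[OF phi_right l[of y]] by (simp add: o_def \<sigma>_def)
    then have "(\<lambda>n. abs_op (ipN (f x) (F (l y n) y)) - abs_op (ipM x y)) \<longlonglongrightarrow> 0"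
      by (rule Lim_null_comparison[rotated]) (simp add: F_right)
    then show "(\<lambda>n. abs_op (ipN (f x) (F (l y n) y))) \<longlonglongrightarrow> abs_op (ipM x y)"
      by (rule LIM_zero_cancel)
  qed (simp_all add: positive_abs_op)
  \<comment> \<open>By \<open>fJ\<close> at \<open>\<sigma> n x\<close>, the absolute value is
    already exact for each \<open>F n x\<close>, so the limit is that of a constant
    sequence.\<close>
  have JJ: "abs_op (ipN (J x) (J y)) = abs_op (ipM x y)" for x y
  proof (rule abs_op_tendsto_unique[OF lim_left])
    have "abs_op (ipN (F n x) (J y)) = abs_op (ipM x y)" for n
      unfolding F_def N.ip_of_real_left
      using c abs_scale_left[of n x y] by (simp add: abs_op_scaleR fJ)
    then show "(\<lambda>n. abs_op (ipN (F (l x n) x) (J y))) \<longlonglongrightarrow> abs_op (ipM x y)" by simp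
  qed (simp_all add: positive_abs_op)
  have J_self: "ipN (J x) (J x) = ipM x x" for x
    using JJ[of x x] by (simp add: abs_op_positive N.ip_positive M.ip_positive)
  \<comment> \<open>The two products come from squaring the absolute values of <Jx, fx> and of its
    adjoint <fx, Jx>.\<close>
  have phase: "adj (ipN (J x) (f x)) o\<^sub>L ipN (J x) (f x) = ipN (J x) (J x) o\<^sub>L ipN (J x) (J x)"
    "ipN (J x) (f x) o\<^sub>L adj (ipN (J x) (f x)) = ipN (J x) (J x) o\<^sub>L ipN (J x) (J x)" for x
    using abs_op_square[of "ipN (J x) (f x)"] abs_op_square[of "ipN (f x) (J x)"]
    by (simp_all add: Jf fJ J_self N.adj_ip abs_op_positive M.ip_positive)
  have "\<forall>x. \<exists>v. ipN v (f x) = ipN (J x) (J x) \<and> ipN v v = ipN (J x) (J x) \<and>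
      actN v (ipN (J x) (J x)) = actN (J x) (ipN (J x) (f x))"
    using N.phase_correction[OF unit compact phase] by blast
  then obtain I where If: "\<And>x. ipN (I x) (f x) = ipM x x" and II: "\<And>x. ipN (I x) (I x) = ipM x x"
    and act_I: "\<And>x. actN (I x) (ipM x x) = actN (J x) (ipN (J x) (f x))"
    unfolding J_self by metis
  \<comment> \<open>A priori this operator lies only in \<open>A\<close>; membership in
    \<open>B\<close> allows it to act on the second module.\<close>
  have mem: "ipM x x \<in> B" for x using N.ip_in[of "J x" "J x"] by (simp add: J_self)
  have fI: "ipN (f x) (I x) = ipM x x" for x
    using N.adj_ip[of "I x" "f x"] by (simp add: If M.adj_ip)
  have rel: "ipM x x o\<^sub>L (ipN (I x) (I y) o\<^sub>L ipM y y)
      = adj (ipN (J x) (f x)) o\<^sub>L (ipN (J x) (J y) o\<^sub>L ipN (J y) (f y))" for x y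
  proof -
    have "ipN (actN (I x) (ipM x x)) (actN (I y) (ipM y y))
        = ipN (actN (J x) (ipN (J x) (f x))) (actN (J y) (ipN (J y) (f y)))" by (simp only: act_I)
    then show ?thesis
      by (simp add: N.ip_act_left N.ip_act_right mem N.ip_in M.adj_ip compose_assoc)
  qed
  have orth: "ipM x y = 0 \<longleftrightarrow> ipN (J x) (J y) = 0" for x y
  proof -
    have zero: "T = 0 \<longleftrightarrow> abs_op T = 0" if "T \<in> bounded_ops" for T :: "'h \<Rightarrow>\<^sub>L 'h"
    proof
      assume "abs_op T = 0"
      then show "T = 0"
        using abs_op_square[OF that] adj_compose_self_eq_zero[OF that] by simp
    qed (simp add: abs_op_positive)
    show ?thesis using zero[of "ipM x y"] zero[of "ipN (J x) (J y)"] by (simp add: JJ)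
  qed
  have orth': "ipN (J x) (J y) = 0 \<longleftrightarrow> ipN (I x) (I y) = 0" for x y
  proof
    assume "ipN (J x) (J y) = 0"
    then have "ipM x x o\<^sub>L (ipN (I x) (I y) o\<^sub>L ipM y y) = 0" by (simp add: rel)
    \<comment> \<open>Multiply by one more factor on each side to reach the form required by
      \<open>N.ip_cancel\<close>.\<close>
    then have "ipM x x o\<^sub>L (ipM x x o\<^sub>L (ipN (I x) (I y) o\<^sub>L (ipM y y o\<^sub>L ipM y y))) = 0"
      by (metis compose_assoc compose_zero_left compose_zero_right)
    then show "ipN (I x) (I y) = 0" by (intro N.ip_cancel) (simp add: II)
  next
    let ?T = "\<lambda>x. ipN (J x) (f x)" and ?S = "ipN (J x) (J y)"
    assume "ipN (I x) (I y) = 0"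
    then have zero: "adj (?T x) o\<^sub>L (?S o\<^sub>L ?T y) = 0" using rel[of x y] by simp
    \<comment> \<open>Multiplying by the outer phases turns them into squares of the diagonal
      products, which can be cancelled.\<close>
    have "(?T x o\<^sub>L adj (?T x)) o\<^sub>L (?S o\<^sub>L (?T y o\<^sub>L adj (?T y)))
        = ?T x o\<^sub>L ((adj (?T x) o\<^sub>L (?S o\<^sub>L ?T y)) o\<^sub>L adj (?T y))"
      by (simp only: compose_assoc)
    also have "\<dots> = 0" by (simp only: zero compose_zero_left compose_zero_right)
    finally show "?S = 0" unfolding phase(2) by (intro N.ip_cancel) (simp only: compose_assoc)
  qed
  \<comment> \<open>The mixed products and <Ix, Ix> all equal <x,x>, so the distance bound is the
    hypothesis at \<open>x, x\<close>.\<close>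
  have diff_self: "ipN (f x - I x) (f x - I x) = ipN (f x) (f x) - ipM x x" for x
    by (simp add: N.ip_diff_left N.ip_diff_right If fI II)
  have dist: "module_norm ipN (f x - I x) \<le> sqrt (\<phi> x x)" for x
    using near[of x x]
    by (simp add: module_norm_def diff_self abs_op_positive N.ip_positive M.ip_positive)
  have wigner: "abs_op (ipN (I x) (I y)) = abs_op (ipM x y)" if "abelian B" for x y
  proof -
    have "adj (ipN (I x) (I y)) o\<^sub>L ipN (I x) (I y) = adj (ipN (J x) (J y)) o\<^sub>L ipN (J x) (J y)"
      by (rule N.abelian_phase_invariance[OF that _ _ N.ip_in phase(2) N.ip_in phase(2)])
        (simp_all add: II J_self rel)
    then have "abs_op (ipN (I x) (I y)) = abs_op (ipN (J x) (J y))"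
      by (intro abs_op_eqI) (simp_all add: positive_abs_op abs_op_square)
    then show ?thesis by (simp add: JJ)
  qed
  show ?thesis
  proof (rule exI[of _ I], intro exI[of _ "\<lambda>x. f x - I x"] conjI allI impI)
    show "ipN (f x - I x) (I x) = 0" for x by (simp add: N.ip_diff_left fI II)
  qed (simp_all add: II orth orth' dist wigner)
qed

end
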